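(* Let $\rho$ range over the density operators on $L^2(\mathbb T,d\theta)$, and let $\Delta_{\rm dis}(N)$ and $\Delta^2_{\rm cho}(\Theta)$ denote the generalized variance of the number observable for the discrete metric on $\mathbb Z$ and the quadratic chordal variance of the angle observable, in the state $\rho$. Then for every $\rho$ $$\Delta_{\rm dis}(N)\ \ge\ 1-\tfrac12\sqrt{\Delta^2_{\rm cho}(\Theta)\,\bigl(4-\Delta^2_{\rm cho}(\Theta)\bigr)}\ ,$$ and this describes the exact tradeoff curve: for every $x\in(0,2]$, the infimum of $\Delta_{\rm dis}(N)$ over all states $\rho$ with $\Delta^2_{\rm cho}(\Theta)\le x$ equals $1-\frac12\sqrt{x(4-x)}$.
   Context: $\mathbb T$ is the circle (angles mod $2\pi$), and $e_n(\theta)=e^{-in\theta}/\sqrt{2\pi}$, $n\in\mathbb Z$. For a density operator $\rho$ on $L^2(\mathbb T,d\theta)$ let $\rho_N(n)=\langle e_n|\rho|e_n\rangle$ be the distribution of the number observable, and let $\rho_\Theta$ be the probability density on $\mathbb T$ of the angle observable, i.e. $\int d\theta\,\rho_\Theta(\theta)f(\theta)=\operatorname{tr}(\rho M_f)$ with $M_f$ multiplication by $f$. Define $$\Delta_{\rm dis}(N)=\min_{m\in\mathbb Z}\sum_{n\in\mathbb Z}\rho_N(n)\,(1-\delta_{nm})=1-\max_m\rho_N(m),$$ $$\Delta^2_{\rm cho}(\Theta)=\min_{\theta'\in\mathbb T}\int d\theta\,\rho_\Theta(\theta)\,\bigl|e^{i\theta}-e^{i\theta'}\bigr|^2=2\Bigl(1-\Bigl|\int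 d\theta\,\rho_\Theta(\theta)e^{i\theta}\Bigr|\Bigr)\in[0,2].$$ *)

theory Defs
  imports "HOL-Analysis.Analysis"
begin

section \<open>The Hilbert space of square-integrable functions on the circle\<close>

text \<open>Angles mod \<open>2\<pi>\<close> are represented by their unique representative in \<open>[0, 2\<pi>)\<close>.\<close>

definition circle :: "real measure" where
  "circle = restrict_space lborel {0..<2 * pi}"

definition square_integrable :: "(real \<Rightarrow> complex) \<Rightarrow> bool" where
  "square_integrable f \<longleftrightarrow>
     f \<in> borel_measurable circle \<and> integrable circle (\<lambda>\<theta>. (cmod (f \<theta>))\<^sup>2)"

definition l2_eq :: "(real \<Rightarrow> complex) \<Rightarrow> (real \<Rightarrow> complex) \<Rightarrow> bool" where
  "l2_eq f g \<longleftrightarrow> square_integrable f \<and> square_integrable g \<and> (AE \<theta> in circle. f \<theta> = g \<theta>)"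

lemma square_integrable_measurable [measurable_dest]:
  "square_integrable f \<Longrightarrow> f \<in> borel_measurable circle"
  by (simp add: square_integrable_def)

lemma space_circle [simp]: "space circle = {0..<2 * pi}"
  by (simp add: circle_def space_restrict_space)

lemma finite_measure_circle: "finite_measure circle"
proof
  show "emeasure circle (space circle) \<noteq> \<infinity>"
    by (simp add: circle_def space_restrict_space emeasure_restrict_space)
qed

lemma square_integrable_zero: "square_integrable (\<lambda>_. 0)"
  by (simp add: square_integrable_def)

lemma square_integrable_bounded:
  assumes [measurable]: "f \<in> borel_measurable circle"
    and "\<And>\<theta>. \<theta> \<in> {0..<2 * pi} \<Longrightarrow> cmod (f \<theta>) \<le> B"
  shows "square_integrable f"
proof -
  have "integrable circle (\<lambda>\<theta>. (cmod (f \<theta>))\<^sup>2)"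
  proof (rule finite_measure.integrable_const_bound[OF finite_measure_circle, where B = "B\<^sup>2"])
    show "AE \<theta> in circle. norm ((cmod (f \<theta>))\<^sup>2) \<le> B\<^sup>2"
      using assms(2) by (intro AE_I2) (simp add: power_mono)
  qed measurable
  then show ?thesis
    by (simp add: square_integrable_def)
qed

lemma square_integrable_scale: "square_integrable f \<Longrightarrow> square_integrable (\<lambda>\<theta>. c * f \<theta>)"
  by (auto simp: square_integrable_def norm_mult power_mult_distrib)

lemma square_integrable_mult:
  assumes f: "square_integrable f" and [measurable]: "h \<in> borel_measurable circle"
    and "bounded (h ` {0..<2 * pi})"
  shows "square_integrable (\<lambda>\<theta>. h \<theta> * f \<theta>)"
proof -
  note [measurable] = square_integrable_measurable[OF f]
  obtain B where B: "\<And>\<theta>. \<theta> \<in> {0..<2 * pi} \<Longrightarrow> cmod (h \<theta>) \<le> B"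
    using assms(3) unfolding bounded_iff by fast
  have "integrable circle (\<lambda>\<theta>. (cmod (h \<theta> * f \<theta>))\<^sup>2)"
  proof (rule Bochner_Integration.integrable_bound)
    show "integrable circle (\<lambda>\<theta>. B\<^sup>2 * (cmod (f \<theta>))\<^sup>2)"
      using f by (simp add: square_integrable_def)
    show "AE \<theta> in circle. norm ((cmod (h \<theta> * f \<theta>))\<^sup>2) \<le> norm (B\<^sup>2 * (cmod (f \<theta>))\<^sup>2)"
      using B by (intro AE_I2) (auto simp: norm_mult power_mult_distrib intro!: mult_right_mono power_mono)
  qed measurable
  then show ?thesis
    by (simp add: square_integrable_def)
qed

lemma square_integrable_add:
  assumes f: "square_integrable f" and g: "square_integrable g"
  shows "square_integrable (\<lambda>\<theta>. f \<theta> + g \<theta>)"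
proof -
  note [measurable] = square_integrable_measurable[OF f] square_integrable_measurable[OF g]
  have "integrable circle (\<lambda>\<theta>. (cmod (f \<theta> + g \<theta>))\<^sup>2)"
  proof (rule Bochner_Integration.integrable_bound)
    show "integrable circle (\<lambda>\<theta>. 2 * (cmod (f \<theta>))\<^sup>2 + 2 * (cmod (g \<theta>))\<^sup>2)"
      using f g by (simp add: square_integrable_def)
    have "(cmod (a + b))\<^sup>2 \<le> 2 * (cmod a)\<^sup>2 + 2 * (cmod b)\<^sup>2" for a b
    proof -
      have "(cmod (a + b))\<^sup>2 \<le> (cmod a + cmod b)\<^sup>2"
        by (intro power_mono norm_triangle_ineq) auto
      also have "\<dots> \<le> 2 * (cmod a)\<^sup>2 + 2 * (cmod b)\<^sup>2"
        using sum_squares_bound[of "cmod a" "cmod b"] by (simp add: power2_sum)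
      finally show ?thesis .
    qed
    then show "AE \<theta> in circle. norm ((cmod (f \<theta> + g \<theta>))\<^sup>2)
        \<le> norm (2 * (cmod (f \<theta>))\<^sup>2 + 2 * (cmod (g \<theta>))\<^sup>2)"
      by (intro AE_I2) auto
  qed measurable
  then show ?thesis
    by (simp add: square_integrable_def)
qed

lemma borel_measurable_cnj_mult:
  fixes f g :: "'a \<Rightarrow> complex"
  assumes f: "f \<in> borel_measurable M" and g: "g \<in> borel_measurable M"
  shows "(\<lambda>x. cnj (f x) * g x) \<in> borel_measurable M"
proof -
  have "(\<lambda>x. cnj (f x)) \<in> borel_measurable M"
    by (rule borel_measurable_continuous_on[OF _ f]) (intro continuous_intros)
  then show ?thesis
    using g by (rule borel_measurable_times)
qed

lemma integrable_cnj_mult: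
  assumes f: "square_integrable f" and g: "square_integrable g"
  shows "integrable circle (\<lambda>\<theta>. cnj (f \<theta>) * g \<theta>)"
proof (rule Bochner_Integration.integrable_bound)
  show "(\<lambda>\<theta>. cnj (f \<theta>) * g \<theta>) \<in> borel_measurable circle"
    using square_integrable_measurable[OF f] square_integrable_measurable[OF g] by (rule borel_measurable_cnj_mult)
  show "integrable circle (\<lambda>\<theta>. (cmod (f \<theta>))\<^sup>2 + (cmod (g \<theta>))\<^sup>2)"
    using f g by (simp add: square_integrable_def)
  have "cmod a * cmod b \<le> (cmod a)\<^sup>2 + (cmod b)\<^sup>2" for a b
    using sum_squares_bound[of "cmod a" "cmod b"] mult_nonneg_nonneg[OF norm_ge_zero norm_ge_zero, of a b]
    by linarith
  then show "AE \<theta> in circle. norm (cnj (f \<theta>) * g \<theta>) \<le> norm ((cmod (f \<theta>))\<^sup>2 + (cmod (g \<theta>))\<^sup>2)"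
    by (intro AE_I2) (auto simp: norm_mult)
qed

quotient_type circle_l2 = "real \<Rightarrow> complex" / partial: l2_eq
proof (rule part_equivpI)
  show "\<exists>f. l2_eq f f"
    using square_integrable_zero by (auto simp: l2_eq_def)
  show "symp l2_eq"
    by (rule sympI) (auto simp: l2_eq_def)
  show "transp l2_eq"
    by (rule transpI) (auto simp: l2_eq_def)
qed

lift_definition cinner :: "circle_l2 \<Rightarrow> circle_l2 \<Rightarrow> complex" is
  "\<lambda>f g. \<integral>\<theta>. cnj (f \<theta>) * g \<theta> \<partial>circle"
proof -
  fix f f' g g' assume "l2_eq f f'" "l2_eq g g'"
  then show "(\<integral>\<theta>. cnj (f \<theta>) * g \<theta> \<partial>circle) = (\<integral>\<theta>. cnj (f' \<theta>) * g' \<theta> \<partial>circle)"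
    by (intro integral_cong_AE) (auto simp: l2_eq_def square_integrable_def intro!: borel_measurable_cnj_mult)
qed

lift_definition cscale :: "complex \<Rightarrow> circle_l2 \<Rightarrow> circle_l2" is
  "\<lambda>c f \<theta>. c * f \<theta>"
  by (auto simp: l2_eq_def intro: square_integrable_scale)

instantiation circle_l2 :: real_vector
begin

lift_definition zero_circle_l2 :: circle_l2 is "\<lambda>_. 0"
  by (simp add: l2_eq_def square_integrable_zero)

lift_definition plus_circle_l2 :: "circle_l2 \<Rightarrow> circle_l2 \<Rightarrow> circle_l2" is
  "\<lambda>f g \<theta>. f \<theta> + g \<theta>"
  by (auto simp: l2_eq_def intro: square_integrable_add)

definition uminus_circle_l2 :: "circle_l2 \<Rightarrow> circle_l2" where
  "- u = cscale (- 1) u"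

definition minus_circle_l2 :: "circle_l2 \<Rightarrow> circle_l2 \<Rightarrow> circle_l2" where
  "u - v = u + (- v :: circle_l2)"

definition scaleR_circle_l2 :: "real \<Rightarrow> circle_l2 \<Rightarrow> circle_l2" where
  "r *\<^sub>R u = cscale (complex_of_real r) u"

instance
proof
  fix u v w :: circle_l2 and r s :: real
  show "u + v + w = u + (v + w)"
    by transfer (auto simp: l2_eq_def add.assoc intro!: square_integrable_add)
  show "u + v = v + u"
    by transfer (auto simp: l2_eq_def add.commute intro!: square_integrable_add)
  show "0 + u = u"
    by transfer (auto simp: l2_eq_def)
  show "- u + u = 0"
    unfolding uminus_circle_l2_def
    by transfer (auto simp: l2_eq_def square_integrable_zero)
  show "u - v = u + - v"
    by (simp add: minus_circle_l2_def)
  show "r *\<^sub>R (u + v) = r *\<^sub>R u + r *\<^sub>R v"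
    unfolding scaleR_circle_l2_def
    by transfer (auto simp: l2_eq_def distrib_left intro!: square_integrable_add square_integrable_scale)
  show "(r + s) *\<^sub>R u = r *\<^sub>R u + s *\<^sub>R u"
    unfolding scaleR_circle_l2_def
    by transfer (auto simp: l2_eq_def distrib_right intro!: square_integrable_add square_integrable_scale)
  show "r *\<^sub>R s *\<^sub>R u = (r * s) *\<^sub>R u"
    unfolding scaleR_circle_l2_def
    by transfer (auto simp: l2_eq_def mult.assoc intro!: square_integrable_scale)
  show "1 *\<^sub>R u = u"
    unfolding scaleR_circle_l2_def
    by transfer (auto simp: l2_eq_def)
qed

end

lemma cinner_commute: "cinner u v = cnj (cinner v u)"
proof transfer
  fix f g :: "real \<Rightarrow> complex"
  have "(\<integral>\<theta>. cnj (f \<theta>) * g \<theta> \<partial>circle) = (\<integral>\<theta>. cnj (cnj (g \<theta>) * f \<theta>) \<partial>circle)"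
    by (simp add: mult.commute)
  also have "\<dots> = cnj (\<integral>\<theta>. cnj (g \<theta>) * f \<theta> \<partial>circle)"
    by (rule Bochner_Integration.integral_cnj)
  finally show "(\<integral>\<theta>. cnj (f \<theta>) * g \<theta> \<partial>circle) = cnj (\<integral>\<theta>. cnj (g \<theta>) * f \<theta> \<partial>circle)" .
qed

lemma cinner_add_right: "cinner u (v + w) = cinner u v + cinner u w"
  by transfer (simp add: l2_eq_def distrib_left integrable_cnj_mult)

lemma cinner_cscale_right: "cinner u (cscale c v) = c * cinner u v"
  by transfer (simp add: mult.left_commute)

lemma cinner_add_left: "cinner (u + v) w = cinner u w + cinner v w"
  by (metis cinner_add_right cinner_commute complex_cnj_add)

lemma cinner_cscale_left: "cinner (cscale c u) v = cnj c * cinner u v"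
  by (metis cinner_cscale_right cinner_commute complex_cnj_mult)

lemma integral_cnj_mult_self:
  "(\<integral>\<theta>. cnj (f \<theta>) * f \<theta> \<partial>circle) = complex_of_real (\<integral>\<theta>. (cmod (f \<theta>))\<^sup>2 \<partial>circle)"
proof -
  have "(\<integral>\<theta>. cnj (f \<theta>) * f \<theta> \<partial>circle) = (\<integral>\<theta>. complex_of_real ((cmod (f \<theta>))\<^sup>2) \<partial>circle)"
    by (intro Bochner_Integration.integral_cong refl) (metis complex_norm_square mult.commute)
  also have "\<dots> = complex_of_real (\<integral>\<theta>. (cmod (f \<theta>))\<^sup>2 \<partial>circle)"
    by (rule integral_complex_of_real)
  finally show ?thesis .
qed

lemma Re_cinner_self_nonneg: "0 \<le> Re (cinner u u)"
  by transfer (simp add: integral_cnj_mult_self)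

lemma Re_cinner_self_eq_0_iff: "Re (cinner u u) = 0 \<longleftrightarrow> u = 0"
  by transfer (auto simp: integral_cnj_mult_self l2_eq_def square_integrable_zero
      square_integrable_def integral_nonneg_eq_0_iff_AE)

instantiation circle_l2 :: real_inner
begin

definition inner_circle_l2 :: "circle_l2 \<Rightarrow> circle_l2 \<Rightarrow> real" where
  "inner_circle_l2 u v = Re (cinner u v)"

definition norm_circle_l2 :: "circle_l2 \<Rightarrow> real" where
  "norm_circle_l2 u = sqrt (Re (cinner u u))"

definition dist_circle_l2 :: "circle_l2 \<Rightarrow> circle_l2 \<Rightarrow> real" where
  "dist_circle_l2 u v = norm (u - v)"

definition sgn_circle_l2 :: "circle_l2 \<Rightarrow> circle_l2" where
  "sgn_circle_l2 u = inverse (norm u) *\<^sub>R u"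

definition uniformity_circle_l2 :: "(circle_l2 \<times> circle_l2) filter" where
  "uniformity_circle_l2 = (INF e\<in>{0<..}. principal {(u, v). dist u v < e})"

definition open_circle_l2 :: "circle_l2 set \<Rightarrow> bool" where
  "open_circle_l2 U \<longleftrightarrow> (\<forall>u\<in>U. \<forall>\<^sub>F (u', v) in uniformity. u' = u \<longrightarrow> v \<in> U)"

instance
proof
  fix u v w :: circle_l2 and r :: real
  show "dist u v = norm (u - v)" "sgn u = inverse (norm u) *\<^sub>R u"
    by (simp_all add: dist_circle_l2_def sgn_circle_l2_def)
  show "(uniformity :: (circle_l2 \<times> circle_l2) filter)
      = (INF e\<in>{0<..}. principal {(u, v). dist u v < e})"
    by (rule uniformity_circle_l2_def)
  show "open U = (\<forall>u\<in>U. \<forall>\<^sub>F (u', v) in uniformity. u' = u \<longrightarrow> v \<in> U)" for U :: "circle_l2 set"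
    by (rule open_circle_l2_def)
  show "u \<bullet> v = v \<bullet> u"
    unfolding inner_circle_l2_def by (subst cinner_commute) simp
  show "(u + v) \<bullet> w = u \<bullet> w + v \<bullet> w" "(r *\<^sub>R u) \<bullet> v = r * (u \<bullet> v)"
    by (simp_all add: inner_circle_l2_def scaleR_circle_l2_def cinner_add_left cinner_cscale_left)
  show "0 \<le> u \<bullet> u" "u \<bullet> u = 0 \<longleftrightarrow> u = 0" "norm u = sqrt (u \<bullet> u)"
    by (simp_all add: inner_circle_l2_def norm_circle_l2_def Re_cinner_self_nonneg Re_cinner_self_eq_0_iff)
qed

end


section \<open>Density operators and the number and angle observables\<close>

lift_definition number_basis :: "int \<Rightarrow> circle_l2" is
  "\<lambda>n \<theta>. exp (- \<i> * of_int n * of_real \<theta>) / of_real (sqrt (2 * pi))"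
proof -
  fix n :: int
  have "square_integrable (\<lambda>\<theta>. exp (- \<i> * of_int n * of_real \<theta>) / of_real (sqrt (2 * pi)))"
  proof (rule square_integrable_bounded[where B = "1 / sqrt (2 * pi)"])
    show "(\<lambda>\<theta>. exp (- \<i> * of_int n * of_real \<theta>) / of_real (sqrt (2 * pi))) \<in> borel_measurable circle"
      unfolding circle_def
      by (intro measurable_restrict_space1 borel_measurable_continuous_onI continuous_intros) auto
  qed (simp add: norm_divide)
  then show "l2_eq (\<lambda>\<theta>. exp (- \<i> * of_int n * of_real \<theta>) / of_real (sqrt (2 * pi)))
      (\<lambda>\<theta>. exp (- \<i> * of_int n * of_real \<theta>) / of_real (sqrt (2 * pi)))"
    by (simp add: l2_eq_def)
qed

text \<open>Multiplication operators are only meaningful for bounded measurable symbols; the value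
  \<open>0\<close> for other symbols is a dummy.\<close>

definition bounded_symbol :: "(real \<Rightarrow> complex) \<Rightarrow> bool" where
  "bounded_symbol h \<longleftrightarrow> h \<in> borel_measurable circle \<and> bounded (h ` {0..<2 * pi})"

lift_definition mult_op :: "(real \<Rightarrow> complex) \<Rightarrow> circle_l2 \<Rightarrow> circle_l2" is
  "\<lambda>h f. if bounded_symbol h then (\<lambda>\<theta>. h \<theta> * f \<theta>) else (\<lambda>_. 0)"
  by (auto simp: l2_eq_def bounded_symbol_def square_integrable_zero intro: square_integrable_mult)

definition bounded_operator :: "(circle_l2 \<Rightarrow> circle_l2) \<Rightarrow> bool" where
  "bounded_operator A \<longleftrightarrow> bounded_linear A \<and> (\<forall>c u. A (cscale c u) = cscale c (A u))"

text \<open>The trace is computed in the orthonormal basis \<open>number_basis\<close>. For trace class operators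
  the series converges absolutely and its value does not depend on the basis; a positive operator
  is trace class iff the series converges.\<close>

definition op_trace :: "(circle_l2 \<Rightarrow> circle_l2) \<Rightarrow> complex" where
  "op_trace A = (\<Sum>\<^sub>\<infinity>n. cinner (number_basis n) (A (number_basis n)))"

definition density_operator :: "(circle_l2 \<Rightarrow> circle_l2) \<Rightarrow> bool" where
  "density_operator \<rho> \<longleftrightarrow>
     bounded_operator \<rho> \<and>
     (\<forall>u. cinner u (\<rho> u) \<in> \<real>\<^sub>\<ge>\<^sub>0) \<and>
     (\<lambda>n. cinner (number_basis n) (\<rho> (number_basis n))) summable_on UNIV \<and>
     op_trace \<rho> = 1"

definition number_distribution :: "(circle_l2 \<Rightarrow> circle_l2) \<Rightarrow> int \<Rightarrow> real" where
  "number_distribution \<rho> n = Re (cinner (number_basis n) (\<rho> (number_basis n)))"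

definition is_angle_density :: "(circle_l2 \<Rightarrow> circle_l2) \<Rightarrow> (real \<Rightarrow> real) \<Rightarrow> bool" where
  "is_angle_density \<rho> p \<longleftrightarrow>
     integrable circle p \<and> (AE \<theta> in circle. 0 \<le> p \<theta>) \<and> (\<integral>\<theta>. p \<theta> \<partial>circle) = 1 \<and>
     (\<forall>h. bounded_symbol h \<longrightarrow>
        (\<integral>\<theta>. complex_of_real (p \<theta>) * h \<theta> \<partial>circle) = op_trace (\<rho> \<circ> mult_op h))"

text \<open>The angle density of a density operator exists and is unique up to null sets.\<close>

definition angle_density :: "(circle_l2 \<Rightarrow> circle_l2) \<Rightarrow> real \<Rightarrow> real" where
  "angle_density \<rho> = (SOME p. is_angle_density \<rho> p)"

text \<open>Both minima below are attained for density operators, so that they coincide with infima.\<close>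

definition discrete_variance :: "(circle_l2 \<Rightarrow> circle_l2) \<Rightarrow> real" where
  "discrete_variance \<rho> =
     (INF m::int. \<Sum>\<^sub>\<infinity>n. number_distribution \<rho> n * (1 - (if n = m then 1 else 0)))"

definition chordal_variance :: "(circle_l2 \<Rightarrow> circle_l2) \<Rightarrow> real" where
  "chordal_variance \<rho> =
     (INF \<theta>'\<in>{0..<2 * pi}.
        \<integral>\<theta>. angle_density \<rho> \<theta> * (cmod (exp (\<i> * of_real \<theta>) - exp (\<i> * of_real \<theta>')))\<^sup>2 \<partial>circle)"

end

(* With p(n) the number distribution and r the mean of exp(i theta) under the angle density, the claim
   reads p(m)^2 + |r|^2 <= 1 for all m. Multiplication by exp(i theta) shifts the number basis by one, so
   r is the sum of the first off-diagonal matrix elements of rho, and positivity of rho bounds each of these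
   by sqrt (p(n) p(n-1)). Split each product into the factor belonging to the index farther from m and
   the factor belonging to the nearer one: summed over n, the former give 1 - p(m), the latter 1 + p(m), and
   Cauchy-Schwarz yields |r|^2 <= (1 - p(m)) (1 + p(m)). Equality holds for the pure state with
   coefficients proportional to kappa^|n|.

   The angle density of rho is obtained from a Cholesky decomposition of rho along the number
   basis into rank one operators |v_k><v_k|, as the sum of the |v_k(theta)|^2; exchanging this sum with the trace needs
   Parseval's identity, that is, completeness of the number basis. *)

theory Submission
  imports Defs "HOL-Library.Nat_Bijection"
begin

section \<open>Density of the trigonometric polynomials\<close>

text \<open>\<open>angle_density\<close> is a choice, so a density must exist for every state before
  the chordal variance says anything about the state. The Cholesky decomposition takes the place of
  a diagonalization: its vectors are triangular with respect to the enumerated basis, so every entry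
  <u|rho b_n> is a finite sum over k, and the only limits left are sums of scalars.
  \<open>op_trace\<close> is an unordered sum that takes the value 0 when it diverges; hence
  convergence of the traces is proved along with their values.

  The extremal state comes from the equality case of the bound: the squared matrix element equals
  p(n) p(n-1), and in each pair the farther probability is the fixed multiple kappa^2 of the nearer
  one. So p decays geometrically on both sides of m, with kappa = |r| / (1 + p(m)). The point x = 0
  is excluded because |r| = 1 would force p(m) = 0 for all m.\<close>

abbreviation l2_class :: "(real \<Rightarrow> complex) \<Rightarrow> circle_l2" where
  "l2_class \<equiv> abs_circle_l2"

lemma l2_eq_refl: "square_integrable f \<Longrightarrow> l2_eq f f"
  by (simp add: l2_eq_def)

lemma square_integrable_rep: "square_integrable (rep_circle_l2 u)"
  using Quotient_rep_reflp[OF Quotient_circle_l2, of u] by (simp add: l2_eq_def)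

lemma l2_class_rep [simp]: "l2_class (rep_circle_l2 u) = u"
  using Quotient_abs_rep[OF Quotient_circle_l2] .

lemma circle_l2_cases:
  obtains f where "square_integrable f" "u = l2_class f"
  by (metis l2_class_rep square_integrable_rep)

lemma cinner_l2_class:
  "square_integrable f \<Longrightarrow> square_integrable g \<Longrightarrow>
    cinner (l2_class f) (l2_class g) = (\<integral>\<theta>. cnj (f \<theta>) * g \<theta> \<partial>circle)"
  by (simp add: cinner.abs_eq l2_eq_refl)

lemma l2_class_add:
  "square_integrable f \<Longrightarrow> square_integrable g \<Longrightarrow>
    l2_class f + l2_class g = l2_class (\<lambda>\<theta>. f \<theta> + g \<theta>)"
  by (simp add: plus_circle_l2.abs_eq l2_eq_refl)

lemma cscale_l2_class:
  "square_integrable f \<Longrightarrow> cscale c (l2_class f) = l2_class (\<lambda>\<theta>. c * f \<theta>)"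
  by (simp add: cscale.abs_eq l2_eq_refl)

lemma l2_class_diff:
  assumes "square_integrable f" "square_integrable g"
  shows "l2_class f - l2_class g = l2_class (\<lambda>\<theta>. f \<theta> - g \<theta>)"
proof -
  have "square_integrable (\<lambda>\<theta>. - 1 * g \<theta>)"
    using assms(2) by (rule square_integrable_scale)
  then show ?thesis
    using assms by (simp add: minus_circle_l2_def uminus_circle_l2_def cscale_l2_class l2_class_add)
qed

lemma mult_op_l2_class:
  "bounded_symbol h \<Longrightarrow> square_integrable f \<Longrightarrow>
    mult_op h (l2_class f) = l2_class (\<lambda>\<theta>. h \<theta> * f \<theta>)"
  by (simp add: mult_op.abs_eq l2_eq_refl)

lemma bounded_symbol_square_integrable:
  "bounded_symbol h \<Longrightarrow> square_integrable f \<Longrightarrow> square_integrable (\<lambda>\<theta>. h \<theta> * f \<theta>)"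
  by (simp add: bounded_symbol_def square_integrable_mult)

definition basis_fun :: "int \<Rightarrow> real \<Rightarrow> complex" where
  "basis_fun n \<theta> = exp (- \<i> * of_int n * of_real \<theta>) / of_real (sqrt (2 * pi))"

lemma number_basis_eq: "number_basis n = l2_class (basis_fun n)"
  by (simp add: number_basis.abs_eq basis_fun_def[abs_def])

lemma borel_measurable_circle_continuous:
  fixes f :: "real \<Rightarrow> complex"
  shows "continuous_on UNIV f \<Longrightarrow> f \<in> borel_measurable circle"
  unfolding circle_def
  by (intro measurable_restrict_space1) (simp add: borel_measurable_continuous_onI)

lemma cmod_basis_fun: "cmod (basis_fun n \<theta>) = 1 / sqrt (2 * pi)"
  by (simp add: basis_fun_def norm_divide)

lemma square_integrable_basis_fun [simp]: "square_integrable (basis_fun n)"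
proof (rule square_integrable_bounded)
  show "basis_fun n \<in> borel_measurable circle"
    unfolding basis_fun_def[abs_def]
    by (intro borel_measurable_circle_continuous continuous_intros) auto
  show "cmod (basis_fun n \<theta>) \<le> 1 / sqrt (2 * pi)" for \<theta>
    by (simp add: cmod_basis_fun)
qed

lemma norm_l2_class_sq:
  assumes "square_integrable f"
  shows "(norm (l2_class f))\<^sup>2 = (\<integral>\<theta>. (cmod (f \<theta>))\<^sup>2 \<partial>circle)"
  using assms by (simp add: norm_circle_l2_def cinner_l2_class integral_cnj_mult_self)

text \<open>Dominated convergence for the squared distance: the limit inherits the bound by |w|, so
  the difference is at most 2 |w|. All approximation steps of this section are instances.\<close>

lemma l2_class_tendsto:
  assumes f: "square_integrable f" and fn: "\<And>n. square_integrable (fn n)"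
    and w: "square_integrable w"
    and le: "\<And>n. AE \<theta> in circle. cmod (fn n \<theta>) \<le> cmod (w \<theta>)"
    and lim: "AE \<theta> in circle. (\<lambda>n. fn n \<theta>) \<longlonglongrightarrow> f \<theta>"
  shows "(\<lambda>n. l2_class (fn n)) \<longlonglongrightarrow> l2_class f"
proof -
  note [measurable] = square_integrable_measurable[OF f] square_integrable_measurable[OF fn]
    square_integrable_measurable[OF w]
  have d: "square_integrable (\<lambda>\<theta>. fn n \<theta> - f \<theta>)" for n
    using square_integrable_add[OF fn square_integrable_scale[OF f, of "-1"]] by simp
  have "(\<lambda>n. \<integral>\<theta>. (cmod (fn n \<theta> - f \<theta>))\<^sup>2 \<partial>circle) \<longlonglongrightarrow> (\<integral>\<theta>. 0 \<partial>circle)"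
  proof (rule integral_dominated_convergence)
    show "integrable circle (\<lambda>\<theta>. (2 * cmod (w \<theta>))\<^sup>2)"
      using w by (simp add: square_integrable_def power_mult_distrib)
    show "AE \<theta> in circle. (\<lambda>n. (cmod (fn n \<theta> - f \<theta>))\<^sup>2) \<longlonglongrightarrow> 0"
      using lim
    proof eventually_elim
      case (elim \<theta>)
      have "(\<lambda>n. (cmod (fn n \<theta> - f \<theta>))\<^sup>2) \<longlonglongrightarrow> (cmod (f \<theta> - f \<theta>))\<^sup>2"
        by (intro tendsto_intros elim)
      then show ?case by simp
    qed
    show "AE \<theta> in circle. norm ((cmod (fn n \<theta> - f \<theta>))\<^sup>2) \<le> (2 * cmod (w \<theta>))\<^sup>2" for n
    proof -
      have "AE \<theta> in circle. \<forall>n. cmod (fn n \<theta>) \<le> cmod (w \<theta>)"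
        using le by (simp add: AE_all_countable)
      then show ?thesis
        using lim
      proof eventually_elim
        case (elim \<theta>)
        have "cmod (f \<theta>) \<le> cmod (w \<theta>)"
          using elim by (intro LIMSEQ_le_const2[OF tendsto_norm[OF elim(2)]]) auto
        then have "cmod (fn n \<theta> - f \<theta>) \<le> 2 * cmod (w \<theta>)"
          using elim(1) norm_triangle_ineq4[of "fn n \<theta>" "f \<theta>"] by (smt (verit))
        then have "(cmod (fn n \<theta> - f \<theta>))\<^sup>2 \<le> (2 * cmod (w \<theta>))\<^sup>2"
          by (intro power_mono) auto
        then show ?case by simp
      qed
    qed
  qed simp_all
  then have "(\<lambda>n. (norm (l2_class (fn n) - l2_class f))\<^sup>2) \<longlonglongrightarrow> 0"
    by (simp add: l2_class_diff f fn norm_l2_class_sq d)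
  then have "(\<lambda>n. sqrt ((norm (l2_class (fn n) - l2_class f))\<^sup>2)) \<longlonglongrightarrow> sqrt 0"
    by (intro tendsto_intros)
  then show ?thesis
    by (simp add: LIM_zero_iff tendsto_norm_zero_iff)
qed

section \<open>Trigonometric polynomials and their span\<close>

inductive trig_poly :: "(real \<Rightarrow> complex) \<Rightarrow> bool" where
  monomial: "trig_poly (\<lambda>\<theta>. c * exp (\<i> * of_int n * of_real \<theta>))"
| add: "trig_poly f \<Longrightarrow> trig_poly g \<Longrightarrow> trig_poly (\<lambda>\<theta>. f \<theta> + g \<theta>)"

lemma trig_poly_mult:
  assumes "trig_poly f" "trig_poly g"
  shows "trig_poly (\<lambda>\<theta>. f \<theta> * g \<theta>)"
  using assms
proof (induction f)
  case (monomial c n)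
  from monomial show ?case
  proof (induction g)
    case (monomial d m)
    have eq: "c * exp (\<i> * of_int n * of_real \<theta>) * (d * exp (\<i> * of_int m * of_real \<theta>))
      = (c * d) * exp (\<i> * of_int (n + m) * of_real \<theta>)" for \<theta>
      by (simp add: exp_add[symmetric] algebra_simps)
    then show ?case
      using trig_poly.monomial[of "c * d" "n + m"] by (simp only: eq)
  next
    case (add f g)
    then show ?case
      by (simp only: distrib_left) (rule trig_poly.add)
  qed
next
  case (add f g)
  then show ?case
    using trig_poly.add by (simp add: distrib_right)
qed

lemma trig_poly_const: "trig_poly (\<lambda>\<theta>. c)"
  using trig_poly.monomial[of c 0] by simp

text \<open>On the unit circle a real linear functional is a combination of cos and sin, hence of
  the exponentials with frequencies 1 and -1; sums and products do the rest.\<close>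

lemma trig_poly_real_polynomial:
  assumes "real_polynomial_function g"
  shows "trig_poly (\<lambda>\<theta>. of_real (g (cis \<theta>)))"
  using assms
proof induction
  case (linear f)
  interpret bounded_linear f by fact
  have "f (cis \<theta>) = f (cos \<theta> *\<^sub>R 1 + sin \<theta> *\<^sub>R \<i>)" for \<theta>
    by (rule arg_cong[of _ _ f]) (simp add: complex_eq_iff)
  then have *: "f (cis \<theta>) = cos \<theta> * f 1 + sin \<theta> * f \<i>" for \<theta>
    by (simp add: add scaleR)
  have c: "of_real (cos \<theta>) = (exp (\<i> * \<theta>) + exp (- (\<i> * \<theta>))) / 2" for \<theta>
    by (simp add: cos_of_real[symmetric] cos_exp_eq)
  have s: "of_real (sin \<theta>) = (exp (\<i> * \<theta>) - exp (- (\<i> * \<theta>))) / (2 * \<i>)" for \<theta>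
    by (simp add: sin_of_real[symmetric] sin_exp_eq)
  have "complex_of_real (f (cis \<theta>)) = ((f 1 - \<i> * f \<i>) / 2) * exp (\<i> * of_int 1 * of_real \<theta>)
      + ((f 1 + \<i> * f \<i>) / 2) * exp (\<i> * of_int (- 1) * of_real \<theta>)" for \<theta>
    unfolding * of_real_add of_real_mult c s
    by (simp add: field_simps)
  then show ?case
    by (simp only:) (intro trig_poly.intros)
next
  case (const c)
  then show ?case by (simp add: trig_poly_const)
next
  case (add f g)
  then show ?case by (simp add: trig_poly.add)
next
  case (mult f g)
  then show ?case by (simp add: trig_poly_mult)
qed

lemma trig_poly_polynomial:
  fixes g :: "complex \<Rightarrow> complex"
  assumes "polynomial_function g"
  shows "trig_poly (\<lambda>\<theta>. g (cis \<theta>))"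
proof -
  have "real_polynomial_function (Re \<circ> g)" "real_polynomial_function (Im \<circ> g)"
    using assms by (auto simp: polynomial_function_def bounded_linear_Re bounded_linear_Im)
  then have "trig_poly (\<lambda>\<theta>. of_real ((Re \<circ> g) (cis \<theta>)) + \<i> * of_real ((Im \<circ> g) (cis \<theta>)))"
    by (intro trig_poly.add trig_poly_mult trig_poly_const trig_poly_real_polynomial)
  then show ?thesis
    by (simp add: complex_eq[symmetric])
qed

text \<open>The complex span of the basis; \<open>span\<close> in the real vector space
  \<open>circle_l2\<close> would allow real coefficients only.\<close>

definition finite_modes :: "circle_l2 set" where
  "finite_modes = {\<Sum>n\<in>F. cscale (c n) (number_basis n) |F c. finite F}"

lemma cscale_zero [simp]: "cscale 0 u = 0"
  by transfer (simp add: l2_eq_def square_integrable_zero)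

lemma cscale_add_left: "cscale (a + b) u = cscale a u + cscale b u"
  by transfer (auto simp: l2_eq_def distrib_right intro!: square_integrable_add square_integrable_scale)

lemma finite_modes_add:
  assumes "u \<in> finite_modes" "v \<in> finite_modes"
  shows "u + v \<in> finite_modes"
proof -
  obtain F c where u: "finite F" "u = (\<Sum>n\<in>F. cscale (c n) (number_basis n))"
    using assms(1) unfolding finite_modes_def by blast
  obtain G d where v: "finite G" "v = (\<Sum>n\<in>G. cscale (d n) (number_basis n))"
    using assms(2) unfolding finite_modes_def by blast
  let ?c = "\<lambda>n. if n \<in> F then c n else 0" and ?d = "\<lambda>n. if n \<in> G then d n else 0"
  have "u = (\<Sum>n\<in>F \<union> G. cscale (?c n) (number_basis n))"
    unfolding u(2) using u(1) v(1) by (intro sum.mono_neutral_cong_left) auto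
  moreover have "v = (\<Sum>n\<in>F \<union> G. cscale (?d n) (number_basis n))"
    unfolding v(2) using u(1) v(1) by (intro sum.mono_neutral_cong_left) auto
  ultimately have "u + v = (\<Sum>n\<in>F \<union> G. cscale (?c n + ?d n) (number_basis n))"
    by (simp add: cscale_add_left sum.distrib)
  moreover have "finite (F \<union> G)"
    using u(1) v(1) by simp
  ultimately show ?thesis
    unfolding finite_modes_def by (intro CollectI exI conjI)
qed

lemma trig_poly_finite_modes:
  assumes "trig_poly f"
  shows "square_integrable f \<and> l2_class f \<in> finite_modes"
  using assms
proof induction
  case (monomial c n)
  \<comment> \<open>\<open>number_basis n\<close> has frequency \<open>- n\<close> and the factor 1
    / sqrt (2 pi), hence the sign and the constant.\<close>
  let ?d = "c * sqrt (2 * pi)"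
  have eq: "(\<lambda>\<theta>. c * exp (\<i> * of_int n * of_real \<theta>)) = (\<lambda>\<theta>. ?d * basis_fun (- n) \<theta>)"
    by (simp add: basis_fun_def)
  have "l2_class (\<lambda>\<theta>. ?d * basis_fun (- n) \<theta>) = cscale ?d (number_basis (- n))"
    by (simp add: number_basis_eq cscale_l2_class)
  also have "\<dots> = (\<Sum>m\<in>{- n}. cscale ?d (number_basis m))"
    by simp
  finally have "l2_class (\<lambda>\<theta>. ?d * basis_fun (- n) \<theta>) \<in> finite_modes"
    unfolding finite_modes_def by (intro CollectI exI[of _ "{- n}"] exI[of _ "\<lambda>_. ?d"]) simp
  then show ?case
    unfolding eq by (simp add: square_integrable_scale)
next
  case (add f g)
  then show ?case
    by (metis finite_modes_add l2_class_add square_integrable_add)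
qed

section \<open>From continuous to bounded to square integrable functions\<close>

text \<open>Stone-Weierstrass on the compact unit circle gives uniform approximation by polynomials
  in Re z and Im z, and on a finite measure space uniform convergence implies convergence in
  L2.\<close>

lemma sphere_continuous_in_closure:
  assumes F: "continuous_on (sphere 0 1) F"
  shows "l2_class (\<lambda>\<theta>. F (cis \<theta>)) \<in> closure finite_modes"
proof -
  have "\<exists>g. polynomial_function g \<and> (\<forall>z\<in>sphere 0 1. cmod (F z - g z) < inverse (real (Suc n)))" for n
    by (rule Stone_Weierstrass_polynomial_function[OF compact_sphere F]) simp
  then obtain g where g: "\<And>n. polynomial_function (g n)"
    and dist_g: "\<And>n z. z \<in> sphere 0 1 \<Longrightarrow> cmod (F z - g n z) < inverse (real (Suc n))"
    by metis
  have tp: "square_integrable (\<lambda>\<theta>. g n (cis \<theta>))" "l2_class (\<lambda>\<theta>. g n (cis \<theta>)) \<in> finite_modes" for n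
    using trig_poly_finite_modes[OF trig_poly_polynomial[OF g]] by auto
  have cF: "continuous_on UNIV (\<lambda>\<theta>. F (cis \<theta>))"
    by (rule continuous_on_compose2[OF F]) (auto intro!: continuous_intros continuous_on_cis)
  have "bounded (F ` sphere 0 1)"
    by (intro compact_imp_bounded compact_continuous_image F compact_sphere)
  then obtain B where B: "\<And>z. z \<in> sphere 0 1 \<Longrightarrow> cmod (F z) \<le> B"
    unfolding bounded_iff by blast
  have "(\<lambda>n. l2_class (\<lambda>\<theta>. g n (cis \<theta>))) \<longlonglongrightarrow> l2_class (\<lambda>\<theta>. F (cis \<theta>))"
  proof (rule l2_class_tendsto)
    show "square_integrable (\<lambda>\<theta>. F (cis \<theta>))"
      by (rule square_integrable_bounded[where B = B]) (auto intro!: borel_measurable_circle_continuous cF B)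
    \<comment> \<open>A constant majorant: every approximation error is at most
      \<open>inverse (real (Suc n))\<close>, so at most 1.\<close>
    show "square_integrable (\<lambda>_. of_real (B + 1))"
      by (rule square_integrable_bounded[where B = "\<bar>B + 1\<bar>"]) (auto simp del: of_real_add)
    show "AE \<theta> in circle. cmod (g n (cis \<theta>)) \<le> cmod (of_real (B + 1))" for n
    proof (rule AE_I2)
      fix \<theta>
      have "cmod (g n (cis \<theta>)) \<le> cmod (F (cis \<theta>)) + cmod (F (cis \<theta>) - g n (cis \<theta>))"
        using norm_triangle_ineq4[of "F (cis \<theta>)" "F (cis \<theta>) - g n (cis \<theta>)"] by simp
      also have "\<dots> \<le> B + inverse (real (Suc n))"
        by (intro add_mono B less_imp_le[OF dist_g]) auto
      also have "\<dots> \<le> B + 1"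
        using inverse_le_1_iff[of "real (Suc n)"] by simp
      also have "\<dots> \<le> cmod (of_real (B + 1))"
        by (metis abs_ge_self norm_of_real)
      finally show "cmod (g n (cis \<theta>)) \<le> cmod (of_real (B + 1))" .
    qed
    show "AE \<theta> in circle. (\<lambda>n. g n (cis \<theta>)) \<longlonglongrightarrow> F (cis \<theta>)"
    proof (rule AE_I2)
      fix \<theta>
      have "(\<lambda>n. F (cis \<theta>) - g n (cis \<theta>)) \<longlonglongrightarrow> 0"
      proof (rule Lim_null_comparison)
        show "\<forall>\<^sub>F n in sequentially. cmod (F (cis \<theta>) - g n (cis \<theta>)) \<le> inverse (real (Suc n))"
          by (intro always_eventually allI less_imp_le[OF dist_g]) simp
        show "(\<lambda>n. inverse (real (Suc n))) \<longlonglongrightarrow> 0"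
          by (rule LIMSEQ_inverse_real_of_nat)
      qed
      from tendsto_diff[OF tendsto_const[of "F (cis \<theta>)"] this]
      show "(\<lambda>n. g n (cis \<theta>)) \<longlonglongrightarrow> F (cis \<theta>)"
        by simp
    qed
  qed (use tp in auto)
  then show ?thesis
    using tp(2) unfolding closure_sequential by (intro exI conjI allI) auto
qed

text \<open>The factor vanishing at \<open>1\<close> removes the jump of \<^const>\<open>Arg2pi\<close> there.\<close>

lemma continuous_on_sphere_Arg2pi_cutoff:
  fixes g :: "real \<Rightarrow> complex"
  assumes g: "continuous_on UNIV g" and B: "\<And>\<theta>. cmod (g \<theta>) \<le> B"
  shows "continuous_on (sphere 0 1) (\<lambda>z. of_real (min 1 (c * cmod (z - 1))) * g (Arg2pi z))"
proof -
  let ?k = "\<lambda>z. complex_of_real (min 1 (c * cmod (z - 1)))"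
  have k: "continuous_on UNIV ?k"
    by (intro continuous_intros)
  have "continuous (at z within sphere 0 1) (\<lambda>z. ?k z * g (Arg2pi z))" if "z \<in> sphere 0 1" for z
  proof (cases "z = 1")
    case True
    have "((\<lambda>z. ?k z * g (Arg2pi z)) \<longlongrightarrow> 0) (at 1 within sphere 0 1)"
    proof (rule Lim_null_comparison)
      show "\<forall>\<^sub>F z in at 1 within sphere 0 1. cmod (?k z * g (Arg2pi z)) \<le> cmod (?k z) * B"
        using B by (simp add: norm_mult mult_left_mono)
      have "((\<lambda>z. cmod (?k z) * B) \<longlongrightarrow> cmod (?k 1) * B) (at 1 within sphere 0 1)"
        using k by (intro tendsto_intros)
      then show "((\<lambda>z. cmod (?k z) * B) \<longlongrightarrow> 0) (at 1 within sphere 0 1)"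
        by simp
    qed
    then show ?thesis
      using True by (simp add: continuous_within)
  next
    case False
    then have "z \<notin> \<real>\<^sub>\<ge>\<^sub>0"
      using that by (auto simp: nonneg_Reals_def)
    then have "continuous (at z) Arg2pi"
      by (rule continuous_at_Arg2pi)
    then have "continuous (at z) (\<lambda>z. g (Arg2pi z))"
      using g by (intro continuous_at_compose[unfolded o_def, of z Arg2pi g])
        (simp_all add: continuous_on_eq_continuous_at)
    moreover have "continuous (at z) ?k"
      using k by (simp add: continuous_on_eq_continuous_at)
    ultimately show ?thesis
      by (intro continuous_at_imp_continuous_at_within[OF continuous_mult])
  qed
  then show ?thesis
    by (simp add: continuous_on_eq_continuous_within)
qed

lemma Arg2pi_cis: "0 \<le> \<theta> \<Longrightarrow> \<theta> < 2 * pi \<Longrightarrow> Arg2pi (cis \<theta>) = \<theta>"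
  by (rule Arg2pi_unique[of 1]) (auto simp: cis_conv_exp)

text \<open>A measurable function is an almost everywhere limit of continuous functions on the line.
  Two corrections turn these into functions covered by \<open>sphere_continuous_in_closure\<close>:
  a projection makes them uniformly bounded, and a cutoff at z = 1 makes them continuous on the
  circle.\<close>

lemma bounded_in_closure:
  assumes f: "f \<in> borel_measurable circle" and B: "\<And>\<theta>. \<theta> \<in> {0..<2 * pi} \<Longrightarrow> cmod (f \<theta>) \<le> B"
  shows "l2_class f \<in> closure finite_modes"
proof -
  have B0: "B \<ge> 0"
    using order_trans[OF norm_ge_zero B[of 0]] by simp
  define S where "S = {0..<2 * pi}"
  have "(\<lambda>\<theta>. if \<theta> \<in> S then f \<theta> else 0) \<in> borel_measurable lborel"
    using f unfolding circle_def S_def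
    by (subst (asm) measurable_restrict_space_iff[where c = 0]) auto
  then have "(\<lambda>\<theta>. if \<theta> \<in> S then f \<theta> else 0) \<in> borel_measurable lebesgue"
    by (rule measurable_completion)
  then have "(\<lambda>\<theta>. if \<theta> \<in> S then f \<theta> else 0) measurable_on UNIV"
    by (rule lebesgue_measurable_imp_measurable_on) simp
  then obtain N g where N: "negligible N" and g: "\<And>n. continuous_on UNIV (g n)"
    and lim: "\<And>\<theta>. \<theta> \<notin> N \<Longrightarrow> (\<lambda>n. g n \<theta>) \<longlonglongrightarrow> (if \<theta> \<in> S then f \<theta> else 0)"
    unfolding measurable_on_def by auto
  \<comment> \<open>Projection onto the ball of radius B is continuous and fixes the values of f, so
    it bounds the approximants without moving their limit.\<close>
  let ?P = "closest_point (cball (0::complex) B)"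
  have contP: "continuous_on UNIV ?P"
    using B0 by (intro continuous_on_closest_point) auto
  have normP: "cmod (?P z) \<le> B" for z
    using closest_point_in_set[of "cball 0 B" z] B0 by auto
  \<comment> \<open>The slope n makes the cutoff eventually equal to 1 at each z other than
    1.\<close>
  define F where "F n z = complex_of_real (min 1 (real n * cmod (z - 1))) * ?P (g n (Arg2pi z))" for n z
  have F: "continuous_on (sphere 0 1) (F n)" for n
    unfolding F_def
    by (rule continuous_on_sphere_Arg2pi_cutoff[OF continuous_on_compose2[OF contP g] normP]) auto
  have cF: "continuous_on UNIV (\<lambda>\<theta>. F n (cis \<theta>))" for n
    by (rule continuous_on_compose2[OF F]) (auto intro!: continuous_intros continuous_on_cis)
  have FB: "cmod (F n z) \<le> B" for n z
  proof -
    have "cmod (F n z) = \<bar>min 1 (real n * cmod (z - 1))\<bar> * cmod (?P (g n (Arg2pi z)))"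
      by (simp add: F_def norm_mult)
    also have "\<dots> \<le> 1 * B"
      by (intro mult_mono normP) auto
    finally show ?thesis by simp
  qed
  have "(\<lambda>n. l2_class (\<lambda>\<theta>. F n (cis \<theta>))) \<longlonglongrightarrow> l2_class f"
  proof (rule l2_class_tendsto)
    show "square_integrable f"
      using f B by (rule square_integrable_bounded)
    show "square_integrable (\<lambda>\<theta>. F n (cis \<theta>))" for n
      by (rule square_integrable_bounded[where B = B]) (auto intro!: borel_measurable_circle_continuous cF FB)
    show "square_integrable (\<lambda>_. of_real B)"
      by (rule square_integrable_bounded[where B = "\<bar>B\<bar>"]) auto
    show "AE \<theta> in circle. cmod (F n (cis \<theta>)) \<le> cmod (of_real B)" for n
      using FB B0 by auto
    \<comment> \<open>The angle 0 joins the exceptional set because the cutoff vanishes there for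
      every n.\<close>
    have "AE \<theta> in lebesgue. \<theta> \<notin> N \<union> {0}"
      using N by (intro AE_not_in) (simp add: negligible_iff_null_sets[symmetric])
    then have "AE \<theta> in lborel. \<theta> \<notin> N \<union> {0}"
      by (simp add: AE_completion_iff)
    then have "AE \<theta> in lborel. \<theta> \<in> S \<longrightarrow> \<theta> \<notin> N \<union> {0}"
      by eventually_elim auto
    then have "AE \<theta> in circle. \<theta> \<notin> N \<union> {0}"
      unfolding circle_def S_def by (subst AE_restrict_space_iff) auto
    moreover have "AE \<theta> in circle. \<theta> \<in> S"
      by (intro AE_I2) (simp add: S_def)
    ultimately show "AE \<theta> in circle. (\<lambda>n. F n (cis \<theta>)) \<longlonglongrightarrow> f \<theta>"
    proof eventually_elim
      case (elim \<theta>)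
      have A: "Arg2pi (cis \<theta>) = \<theta>"
        using elim by (intro Arg2pi_cis) (auto simp: S_def)
      have "cis \<theta> \<noteq> 1"
        using A elim(1) Arg2pi_cis[of 0] by auto
      then have pos: "cmod (cis \<theta> - 1) > 0"
        by simp
      obtain n0 where n0: "real n0 * cmod (cis \<theta> - 1) > 1"
        using reals_Archimedean3[OF pos] by blast
      have one: "min 1 (real n * cmod (cis \<theta> - 1)) = 1" if "n \<ge> n0" for n
      proof -
        have "real n0 * cmod (cis \<theta> - 1) \<le> real n * cmod (cis \<theta> - 1)"
          using that by (intro mult_right_mono) auto
        then show ?thesis using n0 by auto
      qed
      have "(\<lambda>n. ?P (g n \<theta>)) \<longlonglongrightarrow> ?P (f \<theta>)"
        using lim[of \<theta>] elim contP
        by (intro continuous_on_tendsto_compose[OF contP]) simp_all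
      moreover have "?P (f \<theta>) = f \<theta>"
        using B elim(2) by (intro closest_point_self) (simp add: S_def)
      moreover have "\<forall>\<^sub>F n in sequentially. ?P (g n \<theta>) = F n (cis \<theta>)"
        using eventually_ge_at_top[of n0]
      proof eventually_elim
        case (elim n)
        show ?case
          unfolding F_def A one[OF elim] by simp
      qed
      ultimately show ?case
        by (simp add: Lim_transform_eventually)
    qed
  qed
  then show ?thesis
    using closed_sequentially[OF closed_closure sphere_continuous_in_closure[OF F]] by simp
qed

text \<open>A square integrable function is the L2 limit of its truncations to the sets where its
  modulus is at most n, with the function itself as majorant.\<close>

lemma closure_finite_modes: "closure finite_modes = UNIV"
proof -
  have "u \<in> closure finite_modes" for u
  proof -
    obtain f where f: "square_integrable f" and u: "u = l2_class f"
      by (rule circle_l2_cases)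
    note [measurable] = square_integrable_measurable[OF f]
    define fn where "fn n \<theta> = (if cmod (f \<theta>) \<le> real n then f \<theta> else 0)" for n :: nat and \<theta>
    have m [measurable]: "fn n \<in> borel_measurable circle" for n
      unfolding fn_def[abs_def] by measurable
    have b: "cmod (fn n \<theta>) \<le> real n" for n \<theta>
      by (simp add: fn_def)
    have "(\<lambda>n. l2_class (fn n)) \<longlonglongrightarrow> l2_class f"
    proof (rule l2_class_tendsto[OF f _ f])
      show "square_integrable (fn n)" for n
        using m b by (rule square_integrable_bounded)
      show "AE \<theta> in circle. cmod (fn n \<theta>) \<le> cmod (f \<theta>)" for n
        by (simp add: fn_def)
      show "AE \<theta> in circle. (\<lambda>n. fn n \<theta>) \<longlonglongrightarrow> f \<theta>"
      proof (rule AE_I2)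
        fix \<theta>
        obtain n0 :: nat where n0: "cmod (f \<theta>) \<le> real n0"
          using real_arch_simple by blast
        have "\<forall>\<^sub>F n in sequentially. f \<theta> = fn n \<theta>"
          using eventually_ge_at_top[of n0] by eventually_elim (use n0 in \<open>auto simp: fn_def\<close>)
        then show "(\<lambda>n. fn n \<theta>) \<longlonglongrightarrow> f \<theta>"
          by (rule Lim_transform_eventually[OF tendsto_const])
      qed
    qed
    moreover have "l2_class (fn n) \<in> closure finite_modes" for n
      using m b by (rule bounded_in_closure)
    ultimately show ?thesis
      unfolding u using closed_sequentially[OF closed_closure, of "\<lambda>n. l2_class (fn n)"] by blast
  qed
  then show ?thesis by auto
qed

section \<open>Positive forms and Parseval's identity\<close>

lemma cinner_zero_right [simp]: "cinner u 0 = 0"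
  using cinner_cscale_right[of u 0 0] by simp

lemma cinner_sum_right: "cinner u (\<Sum>i\<in>I. f i) = (\<Sum>i\<in>I. cinner u (f i))"
  by (induction I rule: infinite_finite_induct) (simp_all add: cinner_add_right)

lemma cinner_sum_left: "cinner (\<Sum>i\<in>I. f i) u = (\<Sum>i\<in>I. cinner (f i) u)"
  by (metis (no_types, lifting) cinner_commute cinner_sum_right cnj_sum sum.cong)

lemma cscale_add_right: "cscale c (u + v) = cscale c u + cscale c v"
  by transfer (auto simp: l2_eq_def distrib_left intro!: square_integrable_add square_integrable_scale)

lemma cscale_cscale [simp]: "cscale a (cscale b u) = cscale (a * b) u"
  by transfer (auto simp: l2_eq_def mult.assoc intro!: square_integrable_scale)

lemma cscale_one [simp]: "cscale 1 u = u"
  by transfer (auto simp: l2_eq_def)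

lemma uminus_eq_cscale: "- u = cscale (- 1) u" for u :: circle_l2
  by (simp add: uminus_circle_l2_def)

lemma scaleR_eq_cscale: "r *\<^sub>R u = cscale (of_real r) u" for u :: circle_l2
  by (simp add: scaleR_circle_l2_def)

lemma cinner_minus_right [simp]: "cinner u (- v) = - cinner u v"
  by (simp add: uminus_eq_cscale cinner_cscale_right)

lemma cinner_diff_right: "cinner u (v - w) = cinner u v - cinner u w"
  using cinner_add_right[of u v "- w"] by simp

lemma cinner_self: "cinner u u = of_real ((norm u)\<^sup>2)"
proof -
  have "Im (cinner u u) = 0"
    using arg_cong[OF cinner_commute[of u u], of Im] by simp
  then show ?thesis
    by (simp add: complex_eq_iff norm_circle_l2_def Re_cinner_self_nonneg)
qed

lemma norm_cscale: "norm (cscale c u) = cmod c * norm u"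
proof -
  have "complex_of_real ((norm (cscale c u))\<^sup>2) = of_real ((cmod c * norm u)\<^sup>2)"
    unfolding cinner_self[symmetric] cinner_cscale_left cinner_cscale_right
    by (simp add: cinner_self power_mult_distrib complex_norm_square[of c, unfolded of_real_power] mult_ac)
  then show ?thesis
    by (simp only: of_real_eq_iff) (simp add: power2_eq_iff_nonneg)
qed

section \<open>Positive operators and the Cauchy-Schwarz inequality\<close>

text \<open>Linearity and positivity are exactly what a Cholesky step preserves by algebra, so the
  notion can be carried through the induction on remainders.\<close>

definition positive_op :: "(circle_l2 \<Rightarrow> circle_l2) \<Rightarrow> bool" where
  "positive_op A \<longleftrightarrow> (\<forall>u v. A (u + v) = A u + A v) \<and> (\<forall>c u. A (cscale c u) = cscale c (A u)) \<and>
     (\<forall>u. cinner u (A u) \<in> \<real>\<^sub>\<ge>\<^sub>0)"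

lemma positive_opD:
  assumes "positive_op A"
  shows "A (u + v) = A u + A v" "A (cscale c u) = cscale c (A u)" "cinner u (A u) \<in> \<real>\<^sub>\<ge>\<^sub>0"
  using assms by (auto simp: positive_op_def)

lemma positive_op_form:
  assumes "positive_op A"
  shows "cinner u (A u) = of_real (Re (cinner u (A u)))" "0 \<le> Re (cinner u (A u))"
  using positive_opD(3)[OF assms, of u] by (auto simp: complex_nonneg_Reals_iff complex_eq_iff)

text \<open>Polarization: reality of the form at u + v settles the imaginary parts, and at u + i v
  the real parts.\<close>

lemma positive_op_hermitian:
  assumes A: "positive_op A"
  shows "cinner u (A v) = cnj (cinner v (A u))"
proof -
  have r: "Im (cinner w (A w)) = 0" for w
    using positive_opD(3)[OF A] by (simp add: complex_nonneg_Reals_iff)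
  have "Im (cinner u (A v) + cinner v (A u)) = 0"
    using r[of "u + v"] r[of u] r[of v] by (simp add: positive_opD[OF A] cinner_add_left cinner_add_right)
  moreover have "Im (\<i> * cinner u (A v) - \<i> * cinner v (A u)) = 0"
    using r[of "u + cscale \<i> v"] r[of u] r[of v]
    by (simp add: positive_opD[OF A] cinner_add_left cinner_add_right cinner_cscale_left cinner_cscale_right)
  ultimately show ?thesis
    by (simp add: complex_eq_iff)
qed

lemma positive_op_Cauchy_Schwarz:
  assumes A: "positive_op A"
  shows "(cmod (cinner u (A v)))\<^sup>2 \<le> Re (cinner u (A u)) * Re (cinner v (A v))"
proof -
  define a b z where "a = Re (cinner u (A u))" and "b = Re (cinner v (A v))" and "z = cinner u (A v)"
  have ab: "0 \<le> a" "0 \<le> b"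
    using positive_op_form(2)[OF A] by (auto simp: a_def b_def)
  have fab: "cinner u (A u) = of_real a" "cinner v (A v) = of_real b"
    unfolding a_def b_def by (rule positive_op_form(1)[OF A])+
  have quad: "0 \<le> a - 2 * t * (cmod z)\<^sup>2 + t\<^sup>2 * (cmod z)\<^sup>2 * b" for t :: real
  proof -
    \<comment> \<open>The factor \<open>cnj z\<close> aligns the phases, so that both cross terms
      become -t |z|^2.\<close>
    let ?c = "- of_real t * cnj z"
    have "cinner (u + cscale ?c v) (A (u + cscale ?c v)) =
      cinner u (A u) + ?c * z + cnj ?c * cnj z + cnj ?c * ?c * cinner v (A v)"
      using positive_op_hermitian[OF A, of v u]
      by (simp add: positive_opD[OF A] cinner_add_left cinner_add_right cinner_cscale_left
          cinner_cscale_right z_def algebra_simps)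
    also have "\<dots> = of_real (a - 2 * t * (cmod z)\<^sup>2 + t\<^sup>2 * (cmod z)\<^sup>2 * b)"
      unfolding fab of_real_add of_real_diff of_real_mult complex_norm_square
      by (simp add: power2_eq_square algebra_simps)
    finally show ?thesis
      using positive_op_form(2)[OF A, of "u + cscale ?c v"] by simp
  qed
  show ?thesis
    unfolding a_def[symmetric] b_def[symmetric] z_def[symmetric]
  proof (cases "b = 0")
    case True
    have "(cmod z)\<^sup>2 = 0"
    proof (rule ccontr)
      assume "(cmod z)\<^sup>2 \<noteq> 0"
      \<comment> \<open>For b = 0 the bound is linear in t, and this t makes it equal to -a -
        2.\<close>
      with quad[of "(a + 1) / (cmod z)\<^sup>2"] True ab show False
        by simp
    qed
    then show "(cmod z)\<^sup>2 \<le> a * b"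
      using True by simp
  next
    case False
    then have "b > 0" using ab by simp
    \<comment> \<open>1 / b is the minimizer of the quadratic in t.\<close>
    with quad[of "1 / b"] show "(cmod z)\<^sup>2 \<le> a * b"
      by (simp add: field_simps power2_eq_square)
  qed
qed

lemma positive_op_id: "positive_op (\<lambda>u. u)"
  by (simp add: positive_op_def cinner_self)

lemma cinner_Cauchy_Schwarz: "cmod (cinner u v) \<le> norm u * norm v"
proof -
  have "(cmod (cinner u v))\<^sup>2 \<le> (norm u * norm v)\<^sup>2"
    using positive_op_Cauchy_Schwarz[OF positive_op_id, of u v] by (simp add: cinner_self power_mult_distrib)
  then show ?thesis
    by (rule power2_le_imp_le) simp
qed

lemma bounded_linear_cinner_right: "bounded_linear (cinner u)"
proof (rule bounded_linear_intro)
  show "norm (cinner u v) \<le> norm v * norm u" for v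
    using cinner_Cauchy_Schwarz[of u v] by (simp add: mult.commute)
qed (simp_all add: cinner_add_right scaleR_eq_cscale cinner_cscale_right scaleR_conv_of_real)

text \<open>Cauchy-Schwarz against the vector \<open>A w\<close> itself. This covers vanishing
  pivots in the Cholesky decomposition.\<close>

lemma positive_op_zero_imp_zero:
  assumes A: "positive_op A" and "Re (cinner w (A w)) = 0"
  shows "A w = 0"
proof -
  have "(cmod (cinner (A w) (A w)))\<^sup>2 \<le> 0"
    using positive_op_Cauchy_Schwarz[OF A, of "A w" w] assms(2) by simp
  then show ?thesis
    by (simp add: cinner_self norm_power)
qed

lemma density_operator_positive: "density_operator \<rho> \<Longrightarrow> positive_op \<rho>"
  unfolding density_operator_def bounded_operator_def positive_op_def
  by (auto simp: linear_add bounded_linear.linear)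

section \<open>Orthonormality, Fourier expansion and Parseval's identity\<close>

text \<open>The fundamental theorem of calculus works on the closed interval; the added endpoint is
  a null set.\<close>

lemma circle_integral_eq: "integral\<^sup>L circle f = (\<integral>\<theta>. indicator {0..2 * pi} \<theta> *\<^sub>R f \<theta> \<partial>lborel)"
  if "f \<in> borel_measurable borel" for f :: "real \<Rightarrow> complex"
proof -
  have "integral\<^sup>L circle f = (\<integral>\<theta>. indicator {0..<2 * pi} \<theta> *\<^sub>R f \<theta> \<partial>lborel)"
    unfolding circle_def by (subst integral_restrict_space) auto
  also have "\<dots> = (\<integral>\<theta>. indicator {0..2 * pi} \<theta> *\<^sub>R f \<theta> \<partial>lborel)"
  proof (rule integral_cong_AE)
    have "AE \<theta> in lborel. \<theta> \<noteq> 2 * pi"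
      by (rule AE_lborel_singleton)
    then show "AE \<theta> in lborel. indicator {0..<2 * pi} \<theta> *\<^sub>R f \<theta> = indicator {0..2 * pi} \<theta> *\<^sub>R f \<theta>"
      by eventually_elim (auto simp: indicator_def)
  qed (use that in measurable)
  finally show ?thesis .
qed

lemma circle_integral_exp:
  "(\<integral>\<theta>. exp (\<i> * of_int k * of_real \<theta>) \<partial>circle) = (if k = 0 then of_real (2 * pi) else 0)"
proof -
  have m: "(\<lambda>\<theta>. exp (\<i> * of_int k * complex_of_real \<theta>)) \<in> borel_measurable borel"
    by (intro borel_measurable_continuous_onI continuous_intros)
  have "(\<integral>\<theta>. exp (\<i> * of_int k * of_real \<theta>) \<partial>circle) =
    (\<integral>\<theta>. indicator {0..2 * pi} \<theta> *\<^sub>R exp (\<i> * of_int k * of_real \<theta>) \<partial>lborel)"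
    by (rule circle_integral_eq[OF m])
  also have "\<dots> = (if k = 0 then of_real (2 * pi) else 0)"
  proof (cases "k = 0")
    case True
    then show ?thesis by (simp add: scaleR_conv_of_real)
  next
    case False
    let ?F = "\<lambda>\<theta>. exp (\<i> * of_int k * complex_of_real \<theta>) / (\<i> * of_int k)"
    have "(\<integral>\<theta>. indicator {0..2 * pi} \<theta> *\<^sub>R exp (\<i> * of_int k * of_real \<theta>) \<partial>lborel) = ?F (2 * pi) - ?F 0"
    proof (rule integral_FTC_Icc)
      fix x :: real
      have "(?F has_vector_derivative exp (\<i> * of_int k * of_real x)) (at x within {0..2 * pi})"
        using False by (auto intro!: derivative_eq_intros has_vector_derivative_real_field simp: field_simps)
      then show "(?F has_vector_derivative exp (\<i> * of_int k * of_real x)) (at x within {0..2 * pi})" .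
    qed (auto intro!: continuous_intros)
    also have "?F (2 * pi) = ?F 0"
    proof -
      have "exp (\<i> * of_int k * complex_of_real (2 * pi)) = 1"
        unfolding exp_eq_1 by (intro conjI exI[of _ k]) auto
      then show ?thesis by simp
    qed
    finally show ?thesis using False by simp
  qed
  finally show ?thesis .
qed

lemma number_basis_orthonormal: "cinner (number_basis m) (number_basis n) = (if m = n then 1 else 0)"
proof -
  have "cinner (number_basis m) (number_basis n) = (\<integral>\<theta>. cnj (basis_fun m \<theta>) * basis_fun n \<theta> \<partial>circle)"
    by (simp add: number_basis_eq cinner_l2_class)
  also have "\<dots> = (\<integral>\<theta>. exp (\<i> * of_int (m - n) * of_real \<theta>) / of_real (2 * pi) \<partial>circle)"
  proof (rule Bochner_Integration.integral_cong[OF refl])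
    fix \<theta>
    have "complex_of_real (sqrt (2 * pi)) * of_real (sqrt (2 * pi)) = of_real (2 * pi)"
      by (simp flip: of_real_mult)
    moreover have "cnj (exp (- \<i> * of_int m * of_real \<theta>)) * exp (- \<i> * of_int n * of_real \<theta>)
        = exp (\<i> * of_int (m - n) * of_real \<theta>)"
      by (simp add: exp_cnj exp_add[symmetric] algebra_simps)
    ultimately show "cnj (basis_fun m \<theta>) * basis_fun n \<theta> = exp (\<i> * of_int (m - n) * of_real \<theta>) / of_real (2 * pi)"
      unfolding basis_fun_def complex_cnj_divide complex_cnj_complex_of_real times_divide_times_eq by simp
  qed
  also have "\<dots> = (\<integral>\<theta>. exp (\<i> * of_int (m - n) * of_real \<theta>) \<partial>circle) / of_real (2 * pi)"
    by (rule integral_divide_zero)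
  also have "\<dots> = (if m = n then 1 else 0)"
    unfolding circle_integral_exp by simp
  finally show ?thesis .
qed

lemma cinner_basis_sum:
  assumes "finite F"
  shows "cinner (number_basis m) (\<Sum>n\<in>F. cscale (c n) (number_basis n)) = (if m \<in> F then c m else 0)"
  using assms by (simp add: cinner_sum_right cinner_cscale_right number_basis_orthonormal if_distrib[of "(*) _"] cong: if_cong)

lemma norm_pythagoras:
  assumes "cinner u v = 0"
  shows "(norm (u + v))\<^sup>2 = (norm u)\<^sup>2 + (norm v)\<^sup>2"
proof -
  have "cinner v u = 0"
    using assms by (metis cinner_commute complex_cnj_zero)
  then have "complex_of_real ((norm (u + v))\<^sup>2) = of_real ((norm u)\<^sup>2 + (norm v)\<^sup>2)"
    using assms unfolding of_real_add cinner_self[symmetric]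
    by (simp add: cinner_add_left cinner_add_right)
  then show ?thesis by (simp only: of_real_eq_iff)
qed

text \<open>Best approximation: the partial sum over G is the orthogonal projection onto the span of
  G, so it is at least as close to u as any q in that span. Density provides q within e, and every
  finite superset of its index set then does as well, which is unordered convergence.\<close>

lemma number_basis_expansion:
  "((\<lambda>n. cscale (cinner (number_basis n) u) (number_basis n)) has_sum u) UNIV"
  unfolding has_sum_def tendsto_iff eventually_finite_subsets_at_top
proof (intro allI impI)
  fix e :: real assume e: "e > 0"
  have "u \<in> closure finite_modes" by (simp add: closure_finite_modes)
  then obtain q where q: "q \<in> finite_modes" "dist q u < e"
    using e unfolding closure_approachable by blast
  then obtain F c where F: "finite F" and q_eq: "q = (\<Sum>n\<in>F. cscale (c n) (number_basis n))"
    unfolding finite_modes_def by blast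
  let ?P = "\<lambda>G. \<Sum>n\<in>G. cscale (cinner (number_basis n) u) (number_basis n)"
  have "dist (?P G) u < e" if G: "finite G" "F \<subseteq> G" for G
  proof -
    have q_eq': "q = (\<Sum>n\<in>G. cscale (if n \<in> F then c n else 0) (number_basis n))"
      unfolding q_eq using G by (intro sum.mono_neutral_cong_left) auto
    have d: "?P G - q = (\<Sum>n\<in>G. cscale (cinner (number_basis n) u - (if n \<in> F then c n else 0)) (number_basis n))"
      unfolding q_eq' sum_subtractf[symmetric]
      by (intro sum.cong refl) (simp add: uminus_eq_cscale cscale_add_left[symmetric] diff_conv_add_uminus del: add_uminus_conv_diff)
    \<comment> \<open>The error is orthogonal to the span of G, so Pythagoras applies to u - q =
      (\<open>?P G\<close> - q) + (u - \<open>?P G\<close>).\<close>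
    have "cinner (?P G - q) (u - ?P G) = 0"
      unfolding d cinner_sum_left cinner_cscale_left
      by (intro sum.neutral) (simp add: cinner_diff_right cinner_basis_sum G)
    from norm_pythagoras[OF this] have "(norm (u - ?P G))\<^sup>2 \<le> (norm (u - q))\<^sup>2"
      by simp
    then have "norm (u - ?P G) \<le> norm (u - q)"
      by (rule power2_le_imp_le) simp
    also have "\<dots> < e"
      using q(2) by (simp add: dist_norm norm_minus_commute)
    finally show ?thesis
      by (simp add: dist_norm norm_minus_commute)
  qed
  then show "\<exists>X. finite X \<and> X \<subseteq> UNIV \<and> (\<forall>Y. finite Y \<and> X \<subseteq> Y \<and> Y \<subseteq> UNIV \<longrightarrow> dist (?P Y) u < e)"
    using F by blast
qed

lemma parseval: "((\<lambda>n. cinner u (number_basis n) * cinner (number_basis n) v) has_sum cinner u v) UNIV"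
  using has_sum_bounded_linear[OF bounded_linear_cinner_right number_basis_expansion, of u v]
  by (simp add: cinner_cscale_right mult.commute)

lemma parseval_norm: "((\<lambda>n. (cmod (cinner u (number_basis n)))\<^sup>2) has_sum (norm u)\<^sup>2) UNIV"
proof -
  have "cinner u (number_basis n) * cinner (number_basis n) u = of_real ((cmod (cinner u (number_basis n)))\<^sup>2)" for n
    using cinner_commute[of "number_basis n" u] by (simp only: complex_norm_square)
  with parseval[of u u] show ?thesis
    by (simp only: cinner_self has_sum_of_real_iff)
qed

section \<open>Existence of the angle density\<close>

text \<open>Symmetric Gaussian elimination: with w = R_k b_k, step k subtracts |w><w| / <b_k|w>. If
  the pivot is 0, division by zero makes the subtracted term 0, and this is right because positivity
  gives w = 0.\<close>

primrec cholesky_remainder :: "(circle_l2 \<Rightarrow> circle_l2) \<Rightarrow> (nat \<Rightarrow> circle_l2) \<Rightarrow> nat \<Rightarrow> circle_l2 \<Rightarrow> circle_l2" where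
  "cholesky_remainder A b 0 = A"
| "cholesky_remainder A b (Suc k) = (\<lambda>u. cholesky_remainder A b k u -
     cscale (cinner (b k) (cholesky_remainder A b k u) / cinner (b k) (cholesky_remainder A b k (b k)))
       (cholesky_remainder A b k (b k)))"

text \<open>Scaled so that |v_k><v_k| is exactly the operator subtracted in step k; a zero pivot
  yields the zero vector.\<close>

definition cholesky_vector :: "(circle_l2 \<Rightarrow> circle_l2) \<Rightarrow> (nat \<Rightarrow> circle_l2) \<Rightarrow> nat \<Rightarrow> circle_l2" where
  "cholesky_vector A b k =
     cscale (1 / of_real (sqrt (Re (cinner (b k) (cholesky_remainder A b k (b k)))))) (cholesky_remainder A b k (b k))"

text \<open>The new form is the Schur complement <u|Au> - |<w|Au>|^2 / <w|Aw>, nonnegative by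
  Cauchy-Schwarz.\<close>

lemma positive_op_deflate:
  assumes A: "positive_op A"
  shows "positive_op (\<lambda>u. A u - cscale (cinner w (A u) / cinner w (A w)) (A w))"
proof -
  have "cinner u (A u - cscale (cinner w (A u) / cinner w (A w)) (A w)) \<in> \<real>\<^sub>\<ge>\<^sub>0" for u
  proof -
    define a b where "a = Re (cinner u (A u))" and "b = Re (cinner w (A w))"
    have fab: "cinner u (A u) = of_real a" "cinner w (A w) = of_real b"
      unfolding a_def b_def by (rule positive_op_form(1)[OF A])+
    have b0: "b \<ge> 0"
      unfolding b_def by (rule positive_op_form(2)[OF A])
    have CS: "(cmod (cinner w (A u)))\<^sup>2 \<le> b * a"
      unfolding a_def b_def by (rule positive_op_Cauchy_Schwarz[OF A])
    have "cinner u (A u - cscale (cinner w (A u) / cinner w (A w)) (A w)) =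
        of_real a - cinner w (A u) * cnj (cinner w (A u)) / of_real b"
      using positive_op_hermitian[OF A, of u w] fab by (simp add: cinner_diff_right cinner_cscale_right)
    also have "\<dots> = of_real (a - (cmod (cinner w (A u)))\<^sup>2 / b)"
      unfolding complex_norm_square[symmetric] by simp
    finally have eq: "cinner u (A u - cscale (cinner w (A u) / cinner w (A w)) (A w)) =
      of_real (a - (cmod (cinner w (A u)))\<^sup>2 / b)" .
    have "0 \<le> a"
      unfolding a_def by (rule positive_op_form(2)[OF A])
    \<comment> \<open>For b = 0 the quotient is 0 by convention, and a >= 0 remains.\<close>
    with CS b0 have "0 \<le> a - (cmod (cinner w (A u)))\<^sup>2 / b"
      by (cases "b = 0") (auto simp: field_simps)
    then show ?thesis
      unfolding eq nonneg_Reals_of_real_iff .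
  qed
  then show ?thesis
    unfolding positive_op_def
    by (auto simp: positive_opD[OF A] cinner_add_right cinner_cscale_right add_divide_distrib
        cscale_add_left cscale_add_right uminus_eq_cscale diff_conv_add_uminus simp del: add_uminus_conv_diff)
qed

context
  fixes A :: "circle_l2 \<Rightarrow> circle_l2" and b :: "nat \<Rightarrow> circle_l2"
  assumes A: "positive_op A"
begin

private abbreviation "R \<equiv> cholesky_remainder A b"
private abbreviation "v \<equiv> cholesky_vector A b"

lemma positive_op_cholesky_remainder: "positive_op (R k)"
  by (induction k) (auto simp: A intro: positive_op_deflate)

lemma cholesky_remainder_step: "R k u = R (Suc k) u + cscale (cinner (v k) u) (v k)"
proof -
  let ?c = "Re (cinner (b k) (R k (b k)))"
  have c: "cinner (b k) (R k (b k)) = of_real ?c" "0 \<le> ?c"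
    by (rule positive_op_form[OF positive_op_cholesky_remainder])+
  have "complex_of_real (sqrt ?c) * of_real (sqrt ?c) = of_real ?c"
    unfolding of_real_mult[symmetric] using c(2) by simp
  moreover have "cinner (R k (b k)) u = cinner (b k) (R k u)"
    using positive_op_hermitian[OF positive_op_cholesky_remainder, of "b k" k u]
    by (metis cinner_commute complex_cnj_cnj)
  ultimately have "cscale (cinner (v k) u) (v k) =
     cscale (cinner (b k) (R k u) / cinner (b k) (R k (b k))) (R k (b k))"
    unfolding cholesky_vector_def cinner_cscale_left cscale_cscale
    by (subst (3) c(1)) (simp add: mult.commute)
  then show ?thesis by simp
qed

text \<open>Step k clears b_k by the choice of the coefficient, or finds it already cleared if the
  pivot is 0. A vector cleared earlier stays so, since both terms of the recursion vanish on
  it.\<close>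

lemma cholesky_remainder_kills: "j < k \<Longrightarrow> R k (b j) = 0"
proof (induction k)
  case (Suc k)
  show ?case
  proof (cases "j = k")
    case True
    show ?thesis
    proof (cases "cinner (b k) (R k (b k)) = 0")
      case True
      then have "R k (b k) = 0"
        by (intro positive_op_zero_imp_zero[OF positive_op_cholesky_remainder]) simp
      then show ?thesis using \<open>j = k\<close> by simp
    qed (simp add: \<open>j = k\<close>)
  next
    case False
    then have "R k (b j) = 0" using Suc by simp
    then show ?thesis by simp
  qed
qed simp

lemma cholesky_expansion: "A u = R n u + (\<Sum>k<n. cscale (cinner (v k) u) (v k))"
proof (induction n)
  case (Suc n)
  then show ?case
    unfolding cholesky_remainder_step[of n u] by (simp add: add_ac del: cholesky_remainder.simps(2))
qed simp

lemma cholesky_vector_triangular: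
  assumes "n < k"
  shows "cinner (v k) (b n) = 0"
proof -
  have "cinner (R k (b k)) (b n) = cnj (cinner (b n) (R k (b k)))"
    by (rule cinner_commute)
  also have "\<dots> = cinner (b k) (R k (b n))"
    by (rule positive_op_hermitian[OF positive_op_cholesky_remainder, symmetric])
  also have "\<dots> = 0"
    using cholesky_remainder_kills[OF assms] by simp
  finally show ?thesis
    by (simp add: cholesky_vector_def cinner_cscale_left)
qed

text \<open>The remainder after step n vanishes on \<open>b n\<close>, and by triangularity later
  vectors are orthogonal to \<open>b n\<close>. So the sum has only finitely many nonzero terms, and
  no convergence of operators enters.\<close>

lemma cholesky_has_sum: "((\<lambda>k. cinner (v k) (b n) * cinner u (v k)) has_sum cinner u (A (b n))) UNIV"
proof -
  have "A (b n) = (\<Sum>k<Suc n. cscale (cinner (v k) (b n)) (v k))"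
    using cholesky_expansion[of "b n" "Suc n"] cholesky_remainder_kills[of n "Suc n"]
    by (simp del: cholesky_remainder.simps(2) sum.lessThan_Suc)
  then have eq: "cinner u (A (b n)) = (\<Sum>k<Suc n. cinner (v k) (b n) * cinner u (v k))"
    by (simp only: cinner_sum_right cinner_cscale_right)
  show ?thesis
    by (rule has_sum_finite_neutralI[where B = "{..<Suc n}", OF _ _ _ eq])
      (auto simp: cholesky_vector_triangular)
qed

end

section \<open>Multiplication operators and the density of a sum of rank one operators\<close>

lemma bounded_symbol_cnj: "bounded_symbol h \<Longrightarrow> bounded_symbol (\<lambda>\<theta>. cnj (h \<theta>))"
  using borel_measurable_cnj_mult[of h circle "\<lambda>_. 1"]
  by (auto simp: bounded_symbol_def bounded_iff)

lemma mult_op_adjoint: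
  assumes h: "bounded_symbol h"
  shows "cinner u (mult_op h w) = cinner (mult_op (\<lambda>\<theta>. cnj (h \<theta>)) u) w"
proof -
  obtain f where f: "square_integrable f" "u = l2_class f" by (rule circle_l2_cases)
  obtain g where g: "square_integrable g" "w = l2_class g" by (rule circle_l2_cases)
  show ?thesis
    using h bounded_symbol_cnj[OF h] f g
    by (simp add: mult_op_l2_class cinner_l2_class bounded_symbol_square_integrable mult.assoc mult.left_commute)
qed

lemma norm_mult_op_le:
  assumes h: "bounded_symbol h" and B: "\<And>\<theta>. \<theta> \<in> {0..<2 * pi} \<Longrightarrow> cmod (h \<theta>) \<le> B"
  shows "(norm (mult_op h u))\<^sup>2 \<le> B\<^sup>2 * (norm u)\<^sup>2"
proof -
  obtain f where f: "square_integrable f" "u = l2_class f" by (rule circle_l2_cases)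
  have hf: "square_integrable (\<lambda>\<theta>. h \<theta> * f \<theta>)"
    by (rule bounded_symbol_square_integrable[OF h f(1)])
  have "(\<integral>\<theta>. (cmod (h \<theta> * f \<theta>))\<^sup>2 \<partial>circle) \<le> (\<integral>\<theta>. B\<^sup>2 * (cmod (f \<theta>))\<^sup>2 \<partial>circle)"
  proof (rule integral_mono)
    show "integrable circle (\<lambda>\<theta>. (cmod (h \<theta> * f \<theta>))\<^sup>2)" "integrable circle (\<lambda>\<theta>. B\<^sup>2 * (cmod (f \<theta>))\<^sup>2)"
      using f(1) hf by (auto simp: square_integrable_def)
    show "(cmod (h \<theta> * f \<theta>))\<^sup>2 \<le> B\<^sup>2 * (cmod (f \<theta>))\<^sup>2" if "\<theta> \<in> space circle" for \<theta>
      using B[of \<theta>] that by (auto simp: norm_mult power_mult_distrib intro!: mult_right_mono power_mono)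
  qed
  then show ?thesis
    using h f hf by (simp add: mult_op_l2_class norm_l2_class_sq)
qed

lemma cinner_mult_op_self:
  assumes h: "bounded_symbol h"
  shows "cinner u (mult_op h u) = (\<integral>\<theta>. of_real ((cmod (rep_circle_l2 u \<theta>))\<^sup>2) * h \<theta> \<partial>circle)"
proof -
  let ?f = "rep_circle_l2 u"
  have "cinner u (mult_op h u) = cinner (l2_class ?f) (mult_op h (l2_class ?f))"
    by simp
  also have "\<dots> = (\<integral>\<theta>. cnj (?f \<theta>) * (h \<theta> * ?f \<theta>) \<partial>circle)"
    by (simp only: mult_op_l2_class[OF h square_integrable_rep]
        cinner_l2_class[OF square_integrable_rep bounded_symbol_square_integrable[OF h square_integrable_rep]])
  also have "\<dots> = (\<integral>\<theta>. of_real ((cmod (?f \<theta>))\<^sup>2) * h \<theta> \<partial>circle)"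
    by (simp only: complex_norm_square mult_ac)
  finally show ?thesis .
qed

text \<open>Each vector contributes the density |v_k(theta)|^2 with total mass
  \<open>(norm (v k))\<^sup>2\<close>. The masses are summable, so the densities sum almost
  everywhere, and a bounded symbol can be integrated term by term.\<close>

lemma sum_square_angle_density:
  fixes v :: "nat \<Rightarrow> circle_l2"
  assumes sums: "(\<lambda>k. (norm (v k))\<^sup>2) sums s"
  obtains p where "integrable circle p" "AE \<theta> in circle. 0 \<le> p \<theta>" "(\<integral>\<theta>. p \<theta> \<partial>circle) = s"
    "\<And>h. bounded_symbol h \<Longrightarrow> (\<lambda>k. cinner (v k) (mult_op h (v k))) sums (\<integral>\<theta>. complex_of_real (p \<theta>) * h \<theta> \<partial>circle)"
proof
  define V where "V k \<theta> = (cmod (rep_circle_l2 (v k) \<theta>))\<^sup>2" for k \<theta>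
  define p where "p \<theta> = (\<Sum>k. V k \<theta>)" for \<theta>
  have Vi: "integrable circle (V k)" for k
    using square_integrable_rep[of "v k"] by (simp add: V_def[abs_def] square_integrable_def)
  have Vint: "(\<integral>\<theta>. V k \<theta> \<partial>circle) = (norm (v k))\<^sup>2" for k
    using norm_l2_class_sq[OF square_integrable_rep, of "v k"] by (simp add: V_def[abs_def])
  have V0: "0 \<le> V k \<theta>" for k \<theta>
    by (simp add: V_def)
  note [measurable] = borel_measurable_integrable[OF Vi]
  have summ: "AE \<theta> in circle. summable (\<lambda>k. V k \<theta>)"
  proof -
    \<comment> \<open>Tonelli in the extended reals: the pointwise sum has a finite integral, hence
      is finite almost everywhere.\<close>
    have "(\<integral>\<^sup>+\<theta>. (\<Sum>k. ennreal (V k \<theta>)) \<partial>circle) = (\<Sum>k. \<integral>\<^sup>+\<theta>. ennreal (V k \<theta>) \<partial>circle)"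
      by (rule nn_integral_suminf) measurable
    also have "\<dots> = (\<Sum>k. ennreal ((norm (v k))\<^sup>2))"
      by (simp add: nn_integral_eq_integral[OF Vi] V0 Vint)
    also have "\<dots> = ennreal (\<Sum>k. (norm (v k))\<^sup>2)"
      using sums by (intro suminf_ennreal2) (auto simp: sums_iff)
    finally have "(\<integral>\<^sup>+\<theta>. (\<Sum>k. ennreal (V k \<theta>)) \<partial>circle) \<noteq> \<infinity>"
      by simp
    then have "AE \<theta> in circle. (\<Sum>k. ennreal (V k \<theta>)) \<noteq> \<infinity>"
      by (intro nn_integral_PInf_AE) measurable
    then show ?thesis
      by eventually_elim (auto intro!: summable_suminf_not_top V0)
  qed
  have summ_int: "summable (\<lambda>k. \<integral>\<theta>. V k \<theta> \<partial>circle)"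
    using sums by (auto simp: Vint sums_iff)
  show "integrable circle p"
    unfolding p_def[abs_def]
    by (rule integrable_suminf) (use Vi summ summ_int V0 in auto)
  show "AE \<theta> in circle. 0 \<le> p \<theta>"
    using summ unfolding p_def by eventually_elim (intro suminf_nonneg V0)
  have "(\<lambda>k. \<integral>\<theta>. V k \<theta> \<partial>circle) sums (\<integral>\<theta>. p \<theta> \<partial>circle)"
    unfolding p_def[abs_def]
    by (rule sums_integral) (use Vi summ summ_int V0 in auto)
  then show "(\<integral>\<theta>. p \<theta> \<partial>circle) = s"
    using sums by (simp add: Vint sums_iff)
  fix h assume h: "bounded_symbol h"
  then have hm [measurable]: "h \<in> borel_measurable circle"
    by (simp add: bounded_symbol_def)
  obtain B where B: "\<And>\<theta>. \<theta> \<in> {0..<2 * pi} \<Longrightarrow> cmod (h \<theta>) \<le> B"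
    using h unfolding bounded_symbol_def bounded_iff by fast
  let ?g = "\<lambda>k \<theta>. complex_of_real (V k \<theta>) * h \<theta>"
  have le: "AE \<theta> in circle. norm (?g k \<theta>) \<le> norm (B * V k \<theta>)" for k
    using B V0 by (intro AE_I2) (auto simp: norm_mult abs_mult mult.commute intro!: mult_right_mono order_trans[OF _ abs_ge_self])
  have gi: "integrable circle (?g k)" for k
    by (rule Bochner_Integration.integrable_bound[OF _ _ le]) (use Vi in auto)
  have "(\<lambda>k. \<integral>\<theta>. ?g k \<theta> \<partial>circle) sums (\<integral>\<theta>. (\<Sum>k. ?g k \<theta>) \<partial>circle)"
  proof (rule sums_integral[OF gi])
    show "AE \<theta> in circle. summable (\<lambda>k. norm (?g k \<theta>))"
      using summ by eventually_elim (simp add: norm_mult V0 summable_mult2)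
    show "summable (\<lambda>k. \<integral>\<theta>. norm (?g k \<theta>) \<partial>circle)"
    proof (rule summable_comparison_test')
      show "summable (\<lambda>k. \<bar>B\<bar> * (\<integral>\<theta>. V k \<theta> \<partial>circle))"
        by (intro summable_mult summ_int)
      show "norm (\<integral>\<theta>. norm (?g k \<theta>) \<partial>circle) \<le> \<bar>B\<bar> * (\<integral>\<theta>. V k \<theta> \<partial>circle)" for k
      proof -
        have "(\<integral>\<theta>. norm (?g k \<theta>) \<partial>circle) \<le> (\<integral>\<theta>. norm (B * V k \<theta>) \<partial>circle)"
          by (rule integral_mono_AE) (use gi Vi le in auto)
        then show ?thesis
          by (simp add: abs_mult V0)
      qed
    qed
  qed
  moreover have "(\<integral>\<theta>. (\<Sum>k. ?g k \<theta>) \<partial>circle) = (\<integral>\<theta>. complex_of_real (p \<theta>) * h \<theta> \<partial>circle)"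
  proof (rule integral_cong_AE)
    show "AE \<theta> in circle. (\<Sum>k. ?g k \<theta>) = complex_of_real (p \<theta>) * h \<theta>"
      using summ
      by eventually_elim (simp add: p_def suminf_of_real suminf_mult2[symmetric] summable_of_real)
  qed (auto simp: p_def)
  ultimately show "(\<lambda>k. cinner (v k) (mult_op h (v k))) sums (\<integral>\<theta>. complex_of_real (p \<theta>) * h \<theta> \<partial>circle)"
    by (simp add: cinner_mult_op_self[OF h] V_def)
qed

text \<open>Elimination needs an ordering of the basis with a first element; the enumeration is
  harmless because all sums are unordered.\<close>

definition nat_basis :: "nat \<Rightarrow> circle_l2" where
  "nat_basis n = number_basis (int_decode n)"

lemma has_sum_int_decode: "((\<lambda>n. f (int_decode n)) has_sum s) UNIV \<longleftrightarrow> (f has_sum s) UNIV"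
  using has_sum_reindex_bij_betw[OF bij_int_decode, of f s] .

text \<open>The family <v_k|M_h b_n><b_n|v_k> is summed in two orders: over n first, Parseval leads
  to the integral against the density; over k first, the Cholesky expansion leads to the trace. The
  second conclusion records convergence, which an equation for \<open>op_trace\<close> would
  not.\<close>

lemma angle_density_exists:
  assumes \<rho>: "density_operator \<rho>"
  obtains p where "is_angle_density \<rho> p"
    "\<And>h. bounded_symbol h \<Longrightarrow>
       ((\<lambda>n. cinner (number_basis n) (\<rho> (mult_op h (number_basis n)))) has_sum
         (\<integral>\<theta>. complex_of_real (p \<theta>) * h \<theta> \<partial>circle)) UNIV"
proof -
  let ?b = nat_basis
  have pos: "positive_op \<rho>"
    by (rule density_operator_positive[OF \<rho>])
  define v where "v = cholesky_vector \<rho> ?b"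
  have vs: "((\<lambda>k. cinner (v k) (?b n) * cinner u (v k)) has_sum cinner u (\<rho> (?b n))) UNIV" for n u
    unfolding v_def by (rule cholesky_has_sum[OF pos])
  have trace: "((\<lambda>n. cinner (?b n) (\<rho> (?b n))) has_sum 1) UNIV"
    unfolding nat_basis_def has_sum_int_decode[of "\<lambda>n. cinner (number_basis n) (\<rho> (number_basis n))"]
    using \<rho> by (simp add: density_operator_def op_trace_def has_sum_iff)
  \<comment> \<open>Summing over k gives the diagonal of the state, summing over n gives the squared
    norms of the v_k. Hence these norms add up to the trace 1.\<close>
  let ?a = "\<lambda>(n, k). (cmod (cinner (v k) (?b n)))\<^sup>2"
  have a1: "((\<lambda>k. ?a (n, k)) has_sum Re (cinner (?b n) (\<rho> (?b n)))) UNIV" for n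
  proof -
    have "cinner (v k) (?b n) * cinner (?b n) (v k) = of_real (?a (n, k))" for k
      using cinner_commute[of "?b n" "v k"] by (simp only: complex_norm_square prod.case)
    then show ?thesis
      using has_sum_Re[OF vs[of n "?b n"]] by simp
  qed
  have a2: "((\<lambda>n. Re (cinner (?b n) (\<rho> (?b n)))) has_sum 1) UNIV"
    using has_sum_Re[OF trace] by simp
  have a_summable: "?a summable_on UNIV \<times> UNIV"
    by (rule summable_on_SigmaI[OF a1 has_sum_imp_summable[OF a2]]) auto
  have a_sum: "(?a has_sum 1) (UNIV \<times> UNIV)"
    by (rule has_sum_SigmaI[OF a1 a2 a_summable])
  have pars: "((\<lambda>n. (cmod (cinner u (?b n)))\<^sup>2) has_sum (norm u)\<^sup>2) UNIV" for u
    unfolding nat_basis_def has_sum_int_decode[of "\<lambda>n. (cmod (cinner u (number_basis n)))\<^sup>2"]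
    by (rule parseval_norm)
  have pars2: "((\<lambda>n. cinner u (?b n) * cinner (?b n) w) has_sum cinner u w) UNIV" for u w
    unfolding nat_basis_def has_sum_int_decode[of "\<lambda>n. cinner u (number_basis n) * cinner (number_basis n) w"]
    by (rule parseval)
  have "((\<lambda>(k, n). ?a (n, k)) has_sum 1) (UNIV \<times> UNIV)"
    using a_sum by (subst (asm) has_sum_swap) simp
  then have norms: "((\<lambda>k. (norm (v k))\<^sup>2) has_sum 1) UNIV"
    by (rule has_sum_SigmaD) (use pars in simp)
  obtain p where p: "integrable circle p" "AE \<theta> in circle. 0 \<le> p \<theta>" "(\<integral>\<theta>. p \<theta> \<partial>circle) = 1"
    "\<And>h. bounded_symbol h \<Longrightarrow> (\<lambda>k. cinner (v k) (mult_op h (v k))) sums (\<integral>\<theta>. complex_of_real (p \<theta>) * h \<theta> \<partial>circle)"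
    using sum_square_angle_density[OF has_sum_imp_sums[OF norms]] by blast
  have tr: "((\<lambda>n. cinner (number_basis n) (\<rho> (mult_op h (number_basis n)))) has_sum
         (\<integral>\<theta>. complex_of_real (p \<theta>) * h \<theta> \<partial>circle)) UNIV" if h: "bounded_symbol h" for h
  proof -
    obtain B where B: "\<And>\<theta>. \<theta> \<in> {0..<2 * pi} \<Longrightarrow> cmod (h \<theta>) \<le> B"
      using h unfolding bounded_symbol_def bounded_iff by fast
    \<comment> \<open>With the adjoint moved onto v_k, both factors are coefficients in the basis,
      so Parseval applies in n.\<close>
    define w where "w k = mult_op (\<lambda>\<theta>. cnj (h \<theta>)) (v k)" for k
    have w: "cinner (v k) (mult_op h u) = cinner (w k) u" for k u
      unfolding w_def by (rule mult_op_adjoint[OF h])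
    have wB: "(norm (w k))\<^sup>2 \<le> B\<^sup>2 * (norm (v k))\<^sup>2" for k
      unfolding w_def by (rule norm_mult_op_le[OF bounded_symbol_cnj[OF h]]) (simp add: B)
    \<comment> \<open>Both families are square summable over (k, n), the first because
      multiplication enlarges norms by at most the factor B; so their product is absolutely summable
      and the order can be exchanged.\<close>
    let ?x = "\<lambda>(k, n). cinner (w k) (?b n)" and ?y = "\<lambda>(k, n). cinner (?b n) (v k)"
    have "(\<lambda>k. (norm (w k))\<^sup>2) summable_on UNIV"
      by (rule summable_on_comparison_test[OF summable_on_cmult_right[OF has_sum_imp_summable[OF norms], of "B\<^sup>2"]])
        (use wB in auto)
    then have "(\<lambda>(k, n). (cmod (cinner (w k) (?b n)))\<^sup>2) summable_on (UNIV \<times> UNIV)"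
      by (intro summable_on_SigmaI[where g = "\<lambda>k. (norm (w k))\<^sup>2"]) (use pars in auto)
    then have x: "(\<lambda>i. norm (?x i * ?x i)) summable_on (UNIV \<times> UNIV)"
      by (simp add: norm_mult power2_eq_square case_prod_unfold)
    have "(\<lambda>(k, n). (cmod (cinner (v k) (?b n)))\<^sup>2) summable_on (UNIV \<times> UNIV)"
      by (intro summable_on_SigmaI[where g = "\<lambda>k. (norm (v k))\<^sup>2"]) (use pars has_sum_imp_summable[OF norms] in auto)
    moreover have "cmod (cinner (v k) (?b n)) = cmod (cinner (?b n) (v k))" for k n
      by (subst cinner_commute) simp
    ultimately have y: "(\<lambda>i. norm (?y i * ?y i)) summable_on (UNIV \<times> UNIV)"
      by (simp add: norm_mult power2_eq_square case_prod_unfold)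
    have "(\<lambda>i. ?x i * ?y i) summable_on (UNIV \<times> UNIV)"
      by (rule abs_summable_summable[OF abs_summable_product[OF x y]])
    then obtain T where T: "((\<lambda>i. ?x i * ?y i) has_sum T) (UNIV \<times> UNIV)"
      by (auto simp: summable_on_def)
    then have "((\<lambda>k. cinner (w k) (v k)) has_sum T) UNIV"
      by (rule has_sum_SigmaD) (use pars2 in simp)
    then have "(\<lambda>k. cinner (v k) (mult_op h (v k))) sums T"
      unfolding w by (rule has_sum_imp_sums)
    with p(4)[OF h] have T_eq: "T = (\<integral>\<theta>. complex_of_real (p \<theta>) * h \<theta> \<partial>circle)"
      by (rule sums_unique2[symmetric])
    have "((\<lambda>(n, k). ?x (k, n) * ?y (k, n)) has_sum T) (UNIV \<times> UNIV)"
      using T by (subst (asm) has_sum_swap) (simp add: case_prod_unfold)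
    then have "((\<lambda>n. cinner (?b n) (\<rho> (mult_op h (?b n)))) has_sum T) UNIV"
    proof (rule has_sum_SigmaD)
      fix n
      \<comment> \<open>The Cholesky sum describes the operator on basis vectors only, so
        hermiticity is used to let it act on \<open>?b n\<close> and not on
        \<open>mult_op h (?b n)\<close>.\<close>
      have "cinner (?b n) (\<rho> (mult_op h (?b n))) = cnj (cinner (mult_op h (?b n)) (\<rho> (?b n)))"
        by (rule positive_op_hermitian[OF pos])
      moreover have "((\<lambda>k. cnj (cinner (v k) (?b n) * cinner (mult_op h (?b n)) (v k))) has_sum
          cnj (cinner (mult_op h (?b n)) (\<rho> (?b n)))) UNIV"
        unfolding has_sum_cnj_iff by (rule vs)
      moreover have "cnj (cinner (v k) (?b n) * cinner (mult_op h (?b n)) (v k)) =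
          cinner (w k) (?b n) * cinner (?b n) (v k)" for k
        unfolding w[symmetric] complex_cnj_mult
        by (simp add: cinner_commute[of "v k" "mult_op h (?b n)"] cinner_commute[of "?b n" "v k"])
      ultimately show "((\<lambda>k. (\<lambda>(n, k). ?x (k, n) * ?y (k, n)) (n, k)) has_sum
          cinner (?b n) (\<rho> (mult_op h (?b n)))) UNIV"
        by simp
    qed
    then show ?thesis
      unfolding nat_basis_def has_sum_int_decode[of "\<lambda>n. cinner (number_basis n) (\<rho> (mult_op h (number_basis n)))"]
      T_eq .
  qed
  then have "is_angle_density \<rho> p"
    using p by (auto simp: is_angle_density_def op_trace_def intro!: infsumI[symmetric])
  with tr that show thesis by blast
qed

section \<open>The tradeoff curve\<close>

abbreviation phase :: "real \<Rightarrow> complex" where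
  "phase \<theta> \<equiv> exp (\<i> * of_real \<theta>)"

text \<open>A trace and not an integral, hence free of the choice in \<open>angle_density\<close>;
  the two agree by \<open>is_angle_density\<close>.\<close>

definition circular_mean :: "(circle_l2 \<Rightarrow> circle_l2) \<Rightarrow> complex" where
  "circular_mean \<rho> = op_trace (\<rho> \<circ> mult_op phase)"

lemma bounded_symbol_phase: "bounded_symbol phase"
proof -
  have "phase \<in> borel_measurable circle"
    by (intro borel_measurable_circle_continuous continuous_intros)
  moreover have "bounded (phase ` {0..<2 * pi})"
    unfolding bounded_iff by (intro exI[of _ 1]) auto
  ultimately show ?thesis
    by (simp add: bounded_symbol_def)
qed

text \<open>The index goes down because basis function n has frequency -n.\<close>

lemma mult_op_phase: "mult_op phase (number_basis n) = number_basis (n - 1)"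
proof -
  have "phase \<theta> * basis_fun n \<theta> = basis_fun (n - 1) \<theta>" for \<theta>
    by (simp add: basis_fun_def exp_add[symmetric] algebra_simps)
  then show ?thesis
    by (simp add: number_basis_eq mult_op_l2_class[OF bounded_symbol_phase])
qed

lemma is_angle_density_angle_density:
  assumes "density_operator \<rho>"
  shows "is_angle_density \<rho> (angle_density \<rho>)"
  unfolding angle_density_def
  by (rule angle_density_exists[OF assms]) (rule someI[of "is_angle_density \<rho>"])

lemma circular_mean_has_sum:
  assumes "density_operator \<rho>"
  shows "((\<lambda>n. cinner (number_basis n) (\<rho> (number_basis (n - 1)))) has_sum circular_mean \<rho>) UNIV"
proof -
  obtain p where "((\<lambda>n. cinner (number_basis n) (\<rho> (mult_op phase (number_basis n)))) has_sum
         (\<integral>\<theta>. complex_of_real (p \<theta>) * phase \<theta> \<partial>circle)) UNIV"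
    by (rule angle_density_exists[OF assms]) (use bounded_symbol_phase in blast)
  then show ?thesis
    unfolding mult_op_phase by (simp add: circular_mean_def op_trace_def mult_op_phase has_sum_iff)
qed

text \<open>For unit vectors |a - b|^2 = 2 - 2 Re (cnj b a), so the objective is 2 - 2 Re (cnj
  (phase t) r), smallest when t is the argument of r.\<close>

lemma chordal_variance_eq:
  assumes "density_operator \<rho>"
  shows "chordal_variance \<rho> = 2 * (1 - cmod (circular_mean \<rho>))"
proof -
  define p where "p = angle_density \<rho>"
  define r where "r = circular_mean \<rho>"
  have p: "integrable circle p" "(\<integral>\<theta>. p \<theta> \<partial>circle) = 1"
    "(\<integral>\<theta>. complex_of_real (p \<theta>) * phase \<theta> \<partial>circle) = r"
    using is_angle_density_angle_density[OF assms] bounded_symbol_phase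
    by (auto simp: is_angle_density_def p_def r_def circular_mean_def)
  note [measurable] = borel_measurable_integrable[OF p(1)]
  have pp: "integrable circle (\<lambda>\<theta>. complex_of_real (p \<theta>) * phase \<theta>)"
  proof (rule Bochner_Integration.integrable_bound[OF p(1)])
    show "(\<lambda>\<theta>. complex_of_real (p \<theta>) * phase \<theta>) \<in> borel_measurable circle"
      using bounded_symbol_phase by (intro borel_measurable_times) (auto simp: bounded_symbol_def)
  qed (auto simp: norm_mult)
  have eq: "(\<integral>\<theta>. p \<theta> * (cmod (phase \<theta> - phase t))\<^sup>2 \<partial>circle) = 2 - 2 * Re (cnj (phase t) * r)" for t
  proof -
    have "p \<theta> * (cmod (phase \<theta> - phase t))\<^sup>2 = 2 * p \<theta> - 2 * Re (cnj (phase t) * (of_real (p \<theta>) * phase \<theta>))" for \<theta>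
    proof -
      have "(cmod (a - b))\<^sup>2 = 2 - 2 * Re (cnj b * a)" if "cmod a = 1" "cmod b = 1" for a b
        using arg_cong[OF that(1), of power2] arg_cong[OF that(2), of power2]
        by (simp add: cmod_power2 power2_diff algebra_simps)
      then have "(cmod (phase \<theta> - phase t))\<^sup>2 = 2 - 2 * Re (cnj (phase t) * phase \<theta>)"
        by simp
      moreover have "Re (cnj (phase t) * (of_real (p \<theta>) * phase \<theta>)) = p \<theta> * Re (cnj (phase t) * phase \<theta>)"
        by (simp add: algebra_simps)
      ultimately show ?thesis
        by (simp only:) (simp add: right_diff_distrib)
    qed
    then have "(\<integral>\<theta>. p \<theta> * (cmod (phase \<theta> - phase t))\<^sup>2 \<partial>circle) =
      (\<integral>\<theta>. 2 * p \<theta> - 2 * Re (cnj (phase t) * (of_real (p \<theta>) * phase \<theta>)) \<partial>circle)"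
      by simp
    also have "\<dots> = 2 * (\<integral>\<theta>. p \<theta> \<partial>circle) - 2 * (\<integral>\<theta>. Re (cnj (phase t) * (of_real (p \<theta>) * phase \<theta>)) \<partial>circle)"
    proof -
      have "integrable circle (\<lambda>\<theta>. 2 * Re (cnj (phase t) * (of_real (p \<theta>) * phase \<theta>)))"
        by (intro integrable_mult_right integrable_Re pp)
      then show ?thesis
        using p(1) by (simp only: Bochner_Integration.integral_diff integrable_mult_right integral_mult_right_zero)
    qed
    also have "(\<integral>\<theta>. Re (cnj (phase t) * (of_real (p \<theta>) * phase \<theta>)) \<partial>circle) =
        Re (\<integral>\<theta>. cnj (phase t) * (of_real (p \<theta>) * phase \<theta>) \<partial>circle)"
      by (intro integral_Re integrable_mult_right pp)
    also have "\<dots> = Re (cnj (phase t) * r)"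
      using p(3) by (simp only: integral_mult_right_zero)
    finally show ?thesis by (simp add: p(2))
  qed
  have "chordal_variance \<rho> = (INF t\<in>{0..<2 * pi}. 2 - 2 * Re (cnj (phase t) * r))"
    unfolding chordal_variance_def p_def[symmetric] eq ..
  also have "\<dots> = 2 * (1 - cmod r)"
  proof (rule cInf_eq_minimum)
    \<comment> \<open>This holds for r = 0 too, where \<open>Arg2pi\<close> takes the value 0 and
      every angle is a minimizer.\<close>
    have r_polar: "r = of_real (cmod r) * phase (Arg2pi r)"
      by (rule Arg2pi_eq)
    have unit: "cnj (phase t) * phase t = 1" for t
      by (simp add: exp_cnj exp_add[symmetric])
    have "cnj (phase (Arg2pi r)) * r = of_real (cmod r)"
      by (subst (2) r_polar) (use unit in \<open>simp add: mult.left_commute\<close>)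
    then have "2 * (1 - cmod r) = 2 - 2 * Re (cnj (phase (Arg2pi r)) * r)"
      by simp
    then show "2 * (1 - cmod r) \<in> (\<lambda>t. 2 - 2 * Re (cnj (phase t) * r)) ` {0..<2 * pi}"
      by (rule image_eqI) (simp add: Arg2pi_ge_0 Arg2pi_lt_2pi)
  next
    fix y assume "y \<in> (\<lambda>t. 2 - 2 * Re (cnj (phase t) * r)) ` {0..<2 * pi}"
    then obtain t where y: "y = 2 - 2 * Re (cnj (phase t) * r)" by auto
    have "Re (cnj (phase t) * r) \<le> cmod r"
      using complex_Re_le_cmod[of "cnj (phase t) * r"] by (simp add: norm_mult)
    then show "2 * (1 - cmod r) \<le> y" unfolding y by simp
  qed
  finally show ?thesis by (simp add: r_def)
qed

section \<open>The number distribution and the lower bound\<close>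

lemma number_distribution_has_sum:
  assumes "density_operator \<rho>"
  shows "(number_distribution \<rho> has_sum 1) UNIV"
proof -
  have "((\<lambda>n. cinner (number_basis n) (\<rho> (number_basis n))) has_sum 1) UNIV"
    using assms by (simp add: density_operator_def op_trace_def has_sum_iff)
  from has_sum_Re[OF this] show ?thesis
    by (simp add: number_distribution_def[abs_def])
qed

lemma number_distribution_nonneg:
  "density_operator \<rho> \<Longrightarrow> 0 \<le> number_distribution \<rho> n"
  unfolding number_distribution_def by (intro positive_op_form(2) density_operator_positive)

lemma has_sum_remove:
  fixes f :: "'a \<Rightarrow> 'b::{topological_ab_group_add, t2_space}"
  assumes "(f has_sum s) UNIV"
  shows "(f has_sum (s - f m)) (UNIV - {m})"
proof -
  have "f summable_on (UNIV - {m})"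
    using assms by (intro summable_on_cofin_subset) (auto simp: summable_on_def)
  then obtain t where t: "(f has_sum t) (UNIV - {m})"
    by (auto simp: summable_on_def)
  have "(f has_sum (f m + t)) (insert m (UNIV - {m}))"
    by (rule has_sum_insert) (use t in auto)
  then have "f m + t = s"
    using has_sum_unique[OF _ assms] by (simp add: insert_Diff_single)
  then show ?thesis
    using t by (simp add: algebra_simps flip: \<open>f m + t = s\<close>)
qed

lemma discrete_variance_eq:
  assumes "density_operator \<rho>"
  shows "discrete_variance \<rho> = (INF m. 1 - number_distribution \<rho> m)"
proof -
  have "(\<Sum>\<^sub>\<infinity>n. number_distribution \<rho> n * (1 - (if n = m then 1 else 0))) = 1 - number_distribution \<rho> m" for m
  proof -
    have "(number_distribution \<rho> has_sum (1 - number_distribution \<rho> m)) (UNIV - {m})"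
      by (rule has_sum_remove[OF number_distribution_has_sum[OF assms]])
    then have "((\<lambda>n. number_distribution \<rho> n * (1 - (if n = m then 1 else 0))) has_sum
        (1 - number_distribution \<rho> m)) UNIV"
      by (subst has_sum_cong_neutral[where S = UNIV and T = "UNIV - {m}" and g = "number_distribution \<rho>"]) auto
    then show ?thesis by (rule infsumI)
  qed
  then show ?thesis
    unfolding discrete_variance_def by simp
qed

lemma number_distribution_le_1:
  assumes "density_operator \<rho>"
  shows "number_distribution \<rho> m \<le> 1"
proof -
  have "0 \<le> 1 - number_distribution \<rho> m"
    by (rule has_sum_nonneg[OF has_sum_remove[OF number_distribution_has_sum[OF assms]]])
      (rule number_distribution_nonneg[OF assms])
  then show ?thesis by simp
qed

lemma discrete_variance_le:
  assumes "density_operator \<rho>"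
  shows "discrete_variance \<rho> \<le> 1 - number_distribution \<rho> m"
  unfolding discrete_variance_eq[OF assms]
  by (rule cINF_lower) (auto intro!: bdd_belowI[of _ 0] simp: number_distribution_le_1[OF assms])

text \<open>Cauchy-Schwarz is carried out as a weighted AM-GM inequality in each term, so that one
  comparison of convergent sums suffices. It gives 2 kappa r <= (1 - P m) + kappa^2 (1 + P m), which
  for the chosen kappa reads r^2 / (1 + P m) <= 1 - P m.\<close>

lemma number_distribution_circular_mean:
  assumes \<rho>: "density_operator \<rho>"
  shows "(number_distribution \<rho> m)\<^sup>2 + (cmod (circular_mean \<rho>))\<^sup>2 \<le> 1"
proof -
  define P where "P = number_distribution \<rho>"
  define r where "r = cmod (circular_mean \<rho>)"
  define z where "z n = cinner (number_basis n) (\<rho> (number_basis (n - 1)))" for n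
  \<comment> \<open>the weight that is optimal in the bound on \<open>2 * \<kappa> * r\<close> obtained from AM-GM below\<close>
  define \<kappa> where "\<kappa> = r / (1 + P m)"
  have P0: "0 \<le> P n" for n
    unfolding P_def by (rule number_distribution_nonneg[OF \<rho>])
  have Psum: "(P has_sum 1) UNIV"
    unfolding P_def by (rule number_distribution_has_sum[OF \<rho>])
  have Psum': "((\<lambda>n. P (n - 1)) has_sum 1) UNIV"
    using has_sum_reindex_bij_betw[of "\<lambda>n::int. n - 1" UNIV UNIV P 1] Psum
    by (auto simp: bij_betw_def inj_def surj_def intro: exI[of _ "_ + 1"])
  have zP: "(cmod (z n))\<^sup>2 \<le> P n * P (n - 1)" for n
    unfolding z_def P_def number_distribution_def
    by (rule positive_op_Cauchy_Schwarz[OF density_operator_positive[OF \<rho>]])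
  have \<kappa>0: "0 \<le> \<kappa>"
    using P0 by (simp add: \<kappa>_def r_def)
  \<comment> \<open>\<open>\<alpha> n\<close> takes from \<open>{n - 1, n}\<close> the index farther from \<open>m\<close>, \<open>\<beta> n\<close> the nearer one\<close>
  define \<alpha> \<beta> where "\<alpha> n = (if n > m then P n else P (n - 1))" and "\<beta> n = (if n > m then P (n - 1) else P n)" for n
  have \<alpha>: "(\<alpha> has_sum (1 - P m)) UNIV"
  proof -
    \<comment> \<open>The farther index of the pair runs through every integer except m exactly
      once.\<close>
    have "bij_betw (\<lambda>n. if n > m then n else n - 1) UNIV (UNIV - {m})"
      by (rule bij_betw_byWitness[where f' = "\<lambda>n. if n > m then n else n + 1"]) auto
    from has_sum_reindex_bij_betw[OF this, of P "1 - P m"] has_sum_remove[OF Psum, of m]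
    show ?thesis
      by (simp add: \<alpha>_def[abs_def] if_distrib[of P])
  qed
  \<comment> \<open>The nearer terms are what remains of the total 2 of all pairs.\<close>
  have "((\<lambda>n. P n + P (n - 1) + (- \<alpha> n)) has_sum (1 + 1 + (- (1 - P m)))) UNIV"
    by (intro has_sum_add Psum Psum' has_sum_uminusI \<alpha>)
  moreover have "(\<lambda>n. P n + P (n - 1) + (- \<alpha> n)) = \<beta>"
    by (auto simp: fun_eq_iff \<alpha>_def \<beta>_def)
  ultimately have \<beta>: "(\<beta> has_sum (1 + P m)) UNIV"
    by simp
  have sum: "((\<lambda>n. \<alpha> n + \<kappa>\<^sup>2 * \<beta> n) has_sum ((1 - P m) + \<kappa>\<^sup>2 * (1 + P m))) UNIV"
    by (intro has_sum_add has_sum_cmult_right \<alpha> \<beta>)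
  have le: "cmod (of_real (2 * \<kappa>) * z n) \<le> \<alpha> n + \<kappa>\<^sup>2 * \<beta> n" for n
  proof -
    have ab: "0 \<le> \<alpha> n" "0 \<le> \<beta> n" "\<alpha> n * \<beta> n = P n * P (n - 1)"
      using P0 by (auto simp: \<alpha>_def \<beta>_def)
    have "(cmod (of_real (2 * \<kappa>) * z n))\<^sup>2 = 4 * \<kappa>\<^sup>2 * (cmod (z n))\<^sup>2"
      by (simp add: norm_mult power_mult_distrib)
    also have "\<dots> \<le> 4 * \<kappa>\<^sup>2 * (\<alpha> n * \<beta> n)"
      unfolding ab(3) by (intro mult_left_mono zP) auto
    also have "\<dots> \<le> (\<alpha> n + \<kappa>\<^sup>2 * \<beta> n)\<^sup>2"
      using zero_le_power2[of "\<alpha> n - \<kappa>\<^sup>2 * \<beta> n"] by (simp add: power2_eq_square algebra_simps)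
    finally show ?thesis
      by (rule power2_le_imp_le) (use ab in simp)
  qed
  have "((\<lambda>n. of_real (2 * \<kappa>) * z n) has_sum (of_real (2 * \<kappa>) * circular_mean \<rho>)) UNIV"
    unfolding z_def by (intro has_sum_cmult_right circular_mean_has_sum \<rho>)
  then have "cmod (of_real (2 * \<kappa>) * circular_mean \<rho>) \<le> (1 - P m) + \<kappa>\<^sup>2 * (1 + P m)"
    using sum le by (rule norm_infsum_le)
  then have "2 * \<kappa> * r \<le> (1 - P m) + \<kappa>\<^sup>2 * (1 + P m)"
    using \<kappa>0 by (simp add: norm_mult r_def)
  moreover have "1 + P m > 0"
    using P0[of m] by simp
  moreover from this have "2 * \<kappa> * r = 2 * (r\<^sup>2 / (1 + P m))" "\<kappa>\<^sup>2 * (1 + P m) = r\<^sup>2 / (1 + P m)"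
    by (simp_all add: \<kappa>_def power2_eq_square)
  ultimately have "r\<^sup>2 / (1 + P m) \<le> 1 - P m" "1 + P m > 0"
    by linarith+
  then have "r\<^sup>2 \<le> (1 - P m) * (1 + P m)"
    by (simp add: pos_divide_le_eq)
  then show ?thesis
    by (simp add: P_def r_def power2_eq_square algebra_simps)
qed

text \<open>With V = 2 (1 - r) one has V (4 - V) = 4 (1 - r^2), so half the square root is the
  largest value of p(m) that the quadratic inequality allows.\<close>

lemma discrete_variance_bound:
  assumes \<rho>: "density_operator \<rho>"
  shows "1 - 1 / 2 * sqrt (chordal_variance \<rho> * (4 - chordal_variance \<rho>)) \<le> discrete_variance \<rho>"
  unfolding discrete_variance_eq[OF \<rho>]
proof (rule cINF_greatest)
  fix m
  let ?r = "cmod (circular_mean \<rho>)"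
  have "chordal_variance \<rho> * (4 - chordal_variance \<rho>) = 2\<^sup>2 * (1 - ?r\<^sup>2)"
    unfolding chordal_variance_eq[OF \<rho>] by (simp add: power2_eq_square algebra_simps)
  then have "sqrt (chordal_variance \<rho> * (4 - chordal_variance \<rho>)) = 2 * sqrt (1 - ?r\<^sup>2)"
    by (simp only: real_sqrt_mult real_sqrt_abs abs_numeral)
  moreover have "number_distribution \<rho> m \<le> sqrt (1 - ?r\<^sup>2)"
    using number_distribution_circular_mean[OF \<rho>, of m] by (intro real_le_rsqrt) simp
  ultimately show "1 - 1 / 2 * sqrt (chordal_variance \<rho> * (4 - chordal_variance \<rho>)) \<le> 1 - number_distribution \<rho> m"
    by simp
qed simp

section \<open>Two-sided geometric series and the extremal state\<close>

lemma has_sum_int_split: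
  fixes f :: "int \<Rightarrow> 'a::topological_comm_monoid_add"
  assumes "((\<lambda>k. f (int k + 1)) has_sum s) UNIV" "((\<lambda>k. f (- int k)) has_sum t) UNIV"
  shows "(f has_sum (s + t)) UNIV"
proof -
  have "bij_betw (\<lambda>k. int k + 1) UNIV {1..}"
    by (rule bij_betw_byWitness[where f' = "\<lambda>n. nat (n - 1)"]) auto
  then have 1: "(f has_sum s) {1..}"
    using assms(1) has_sum_reindex_bij_betw by blast
  have "bij_betw (\<lambda>k. - int k) UNIV {..0}"
    by (rule bij_betw_byWitness[where f' = "\<lambda>n. nat (- n)"]) auto
  then have 2: "(f has_sum t) {..0}"
    using assms(2) has_sum_reindex_bij_betw by blast
  have "(f has_sum (s + t)) ({1..} \<union> {..0})"
    by (rule has_sum_Un_disjoint[OF 1 2]) auto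
  moreover have "{1..} \<union> {..0} = (UNIV :: int set)"
    by auto
  ultimately show ?thesis by simp
qed

lemma has_sum_geometric:
  fixes q :: real
  assumes "0 \<le> q" "q < 1"
  shows "((\<lambda>k. c * q ^ k) has_sum (c / (1 - q))) UNIV"
proof -
  have "((\<lambda>k. q ^ k) has_sum (1 / (1 - q))) UNIV"
    using assms by (intro sums_nonneg_imp_has_sum geometric_sums) auto
  from has_sum_cmult_right[OF this, of c] show ?thesis by simp
qed

lemma has_sum_geometric_int:
  fixes q :: real
  assumes "0 \<le> q" "q < 1"
  shows "((\<lambda>n::int. q ^ nat \<bar>n\<bar>) has_sum ((1 + q) / (1 - q))) UNIV"
proof -
  have "((\<lambda>n::int. q ^ nat \<bar>n\<bar>) has_sum (q / (1 - q) + 1 / (1 - q))) UNIV"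
  proof (rule has_sum_int_split)
    have "nat \<bar>int k + 1\<bar> = Suc k" for k by simp
    then show "((\<lambda>k. q ^ nat \<bar>int k + 1\<bar>) has_sum (q / (1 - q))) UNIV"
      using has_sum_geometric[OF assms, of q] by simp
    show "((\<lambda>k. q ^ nat \<bar>- int k\<bar>) has_sum (1 / (1 - q))) UNIV"
      using has_sum_geometric[OF assms, of 1] by simp
  qed
  then show ?thesis
    by (simp add: add_divide_distrib add.commute)
qed

text \<open>Absolute summability makes the series converge uniformly to a bounded function, whose
  coefficients follow by termwise integration. Geometric coefficients are of this kind.\<close>

lemma fourier_series_exists:
  fixes a :: "int \<Rightarrow> complex"
  assumes "(\<lambda>n. cmod (a n)) summable_on UNIV"
  obtains u where "\<And>n. cinner (number_basis n) u = a n"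
proof
  let ?d = "int_decode"
  define g where "g k \<theta> = a (?d k) * basis_fun (?d k) \<theta>" for k \<theta>
  define f where "f \<theta> = (\<Sum>k. g k \<theta>)" for \<theta>
  have "(\<lambda>k. cmod (a (?d k))) summable_on UNIV"
    using assms has_sum_int_decode[of "\<lambda>n. cmod (a n)"] by (auto simp: summable_on_def)
  then have sa: "summable (\<lambda>k. cmod (a (?d k)))"
    by (rule summable_on_imp_summable)
  have gi: "square_integrable (g k)" for k
    unfolding g_def[abs_def] by (intro square_integrable_scale square_integrable_basis_fun)
  note [measurable] = square_integrable_measurable[OF gi]
  have gn: "cmod (g k \<theta>) = cmod (a (?d k)) / sqrt (2 * pi)" for k \<theta>
    by (simp add: g_def norm_mult cmod_basis_fun)
  have sg: "summable (\<lambda>k. cmod (g k \<theta>))" for \<theta>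
    unfolding gn by (intro summable_divide sa)
  have fi: "square_integrable f"
  proof (rule square_integrable_bounded)
    show "f \<in> borel_measurable circle"
      unfolding f_def[abs_def] by measurable
    show "cmod (f \<theta>) \<le> (\<Sum>k. cmod (a (?d k)) / sqrt (2 * pi))" for \<theta>
      using summable_norm[OF sg[of \<theta>]] unfolding f_def gn .
  qed
  have "cinner (number_basis n) (l2_class f) = a n" for n
  proof -
    let ?h = "\<lambda>k \<theta>. cnj (basis_fun n \<theta>) * g k \<theta>"
    have hn: "cmod (?h k \<theta>) = cmod (a (?d k)) / (2 * pi)" for k \<theta>
      by (simp add: norm_mult gn cmod_basis_fun flip: real_sqrt_mult)
    have "(\<lambda>k. \<integral>\<theta>. ?h k \<theta> \<partial>circle) sums (\<integral>\<theta>. (\<Sum>k. ?h k \<theta>) \<partial>circle)"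
    proof (rule sums_integral)
      show "integrable circle (?h k)" for k
        by (intro integrable_cnj_mult gi square_integrable_basis_fun)
      show "AE \<theta> in circle. summable (\<lambda>k. norm (?h k \<theta>))"
        unfolding hn by (intro AE_I2 summable_divide sa)
      show "summable (\<lambda>k. \<integral>\<theta>. norm (?h k \<theta>) \<partial>circle)"
        unfolding hn lebesgue_integral_const by (intro summable_scaleR_right summable_divide sa)
    qed
    moreover have "(\<Sum>k. ?h k \<theta>) = cnj (basis_fun n \<theta>) * f \<theta>" for \<theta>
      unfolding f_def by (rule suminf_mult[OF summable_norm_cancel[OF sg]])
    moreover have "(\<integral>\<theta>. ?h k \<theta> \<partial>circle) = (if k = int_encode n then a n else 0)" for k
    proof -
      have "(\<integral>\<theta>. ?h k \<theta> \<partial>circle) = cinner (number_basis n) (cscale (a (?d k)) (number_basis (?d k)))"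
        by (simp add: number_basis_eq cscale_l2_class cinner_l2_class square_integrable_scale g_def)
      then show ?thesis
        by (auto simp: cinner_cscale_right number_basis_orthonormal)
    qed
    ultimately have "(\<lambda>k. if k = int_encode n then a n else 0) sums (\<integral>\<theta>. cnj (basis_fun n \<theta>) * f \<theta> \<partial>circle)"
      by simp
    from sums_unique2[OF this sums_single[of "int_encode n" "\<lambda>_. a n"]]
    show ?thesis
      by (simp add: number_basis_eq cinner_l2_class fi)
  qed
  then show "\<And>n. cinner (number_basis n) (l2_class f) = a n" .
qed

lemma density_operator_pure:
  assumes "norm u = 1"
  shows "density_operator (\<lambda>w. cscale (cinner u w) u)"
proof -
  have "bounded_linear (\<lambda>w. cscale (cinner u w) u)"
  proof (rule bounded_linear_intro)
    show "norm (cscale (cinner u w) u) \<le> norm w * 1" for w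
      using cinner_Cauchy_Schwarz[of u w] assms by (simp add: norm_cscale)
  qed (simp_all add: cinner_add_right cscale_add_left scaleR_eq_cscale cinner_cscale_right)
  moreover have "cinner w (cscale (cinner u w) u) \<in> \<real>\<^sub>\<ge>\<^sub>0" for w
  proof -
    have "cinner w (cscale (cinner u w) u) = of_real ((cmod (cinner u w))\<^sup>2)"
      unfolding cinner_cscale_right using cinner_commute[of w u] by (simp only: complex_norm_square)
    then show ?thesis
      by (simp only: nonneg_Reals_of_real_iff) simp
  qed
  moreover have "((\<lambda>n. cinner (number_basis n) (cscale (cinner u (number_basis n)) u)) has_sum 1) UNIV"
    using parseval[of u u] assms by (simp add: cinner_cscale_right cinner_self)
  ultimately show ?thesis
    by (auto simp: density_operator_def bounded_operator_def op_trace_def cinner_cscale_right has_sum_iff)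
qed

lemma optimal_state_exists:
  fixes s t :: real
  assumes s: "0 \<le> s" and t: "0 < t" and st: "s\<^sup>2 + t\<^sup>2 = 1"
  obtains \<rho> where "density_operator \<rho>" "cmod (circular_mean \<rho>) = s" "number_distribution \<rho> 0 = t"
proof -
  \<comment> \<open>The weight from \<open>number_distribution_circular_mean\<close> at m = 0, with
    s for r and t for P m.\<close>
  define \<kappa> where "\<kappa> = s / (1 + t)"
  have \<kappa>0: "0 \<le> \<kappa>"
    using s t by (simp add: \<kappa>_def)
  have t1: "1 + t \<noteq> 0" using t by simp
  have ss: "s\<^sup>2 = (1 - t) * (1 + t)"
    using st by (simp add: power2_eq_square algebra_simps)
  have \<kappa>sq: "\<kappa>\<^sup>2 = (1 - t) / (1 + t)"
    using t1 unfolding \<kappa>_def power_divide ss by (simp add: power2_eq_square)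
  have plus: "1 + \<kappa>\<^sup>2 = 2 / (1 + t)" and minus: "1 - \<kappa>\<^sup>2 = 2 * t / (1 + t)"
    using t1 unfolding \<kappa>sq by (simp_all add: field_simps)
  have \<kappa>sq1: "\<kappa>\<^sup>2 < 1"
  proof -
    have "0 < 2 * t / (1 + t)" using t by simp
    then show ?thesis using minus by simp
  qed
  then have \<kappa>1: "\<kappa> < 1"
    using \<kappa>0 by (simp add: power_less_one_iff)
  \<comment> \<open>The factor \<open>sqrt t\<close> makes the probability of 0 equal to t; the
    total is 1 since (1 + kappa^2) / (1 - kappa^2) = 1 / t. For s = 0 the convention 0 ^ 0 = 1
    leaves the basis vector with index 0.\<close>
  define a where "a n = complex_of_real (sqrt t * \<kappa> ^ nat \<bar>n\<bar>)" for n :: int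
  have "(\<lambda>n. cmod (a n)) summable_on UNIV"
    unfolding a_def norm_of_real abs_mult using \<kappa>0 t
    by (simp add: summable_on_cmult_right[OF has_sum_imp_summable[OF has_sum_geometric_int[OF \<kappa>0 \<kappa>1]]])
  then obtain u where u: "cinner (number_basis n) u = a n" for n
    by (rule fourier_series_exists) blast
  have u': "cinner u (number_basis n) = a n" for n
    by (subst cinner_commute) (simp add: u a_def)
  have "((\<lambda>n::int. t * (\<kappa>\<^sup>2) ^ nat \<bar>n\<bar>) has_sum (t * ((1 + \<kappa>\<^sup>2) / (1 - \<kappa>\<^sup>2)))) UNIV"
    by (intro has_sum_cmult_right has_sum_geometric_int) (use \<kappa>sq1 in auto)
  moreover have "t * ((1 + \<kappa>\<^sup>2) / (1 - \<kappa>\<^sup>2)) = 1"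
    unfolding plus minus using t t1 by simp
  moreover have "(cmod (cinner u (number_basis n)))\<^sup>2 = t * (\<kappa>\<^sup>2) ^ nat \<bar>n\<bar>" for n
    using t unfolding u' a_def norm_of_real power2_abs
    by (simp add: power_mult_distrib power_mult[symmetric] mult.commute)
  ultimately have "((\<lambda>n. (cmod (cinner u (number_basis n)))\<^sup>2) has_sum 1) UNIV"
    by (simp only:)
  then have "(norm u)\<^sup>2 = 1"
    using has_sum_unique[OF parseval_norm] by blast
  then have norm_u: "norm u = 1"
    using norm_ge_zero[of u] by (auto simp: power2_eq_1_iff)
  let ?\<rho> = "\<lambda>w. cscale (cinner u w) u"
  have \<rho>: "density_operator ?\<rho>"
    by (rule density_operator_pure[OF norm_u])
  have "number_distribution ?\<rho> 0 = t"
    using t by (simp add: number_distribution_def cinner_cscale_right u u' a_def flip: of_real_mult)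
  moreover have "circular_mean ?\<rho> = of_real s"
  proof -
    have z: "cinner (number_basis n) (?\<rho> (number_basis (n - 1))) = of_real (t * (\<kappa> ^ nat \<bar>n\<bar> * \<kappa> ^ nat \<bar>n - 1\<bar>))" for n
      using t by (simp add: cinner_cscale_right u u' a_def flip: of_real_mult)
    \<comment> \<open>The exponent |n| + |n - 1| takes each odd value 2 k + 1 twice, at n = k + 1
      and at n = -k.\<close>
    have two_sided: "((\<lambda>n::int. \<kappa> ^ nat \<bar>n\<bar> * \<kappa> ^ nat \<bar>n - 1\<bar>) has_sum (\<kappa> / (1 - \<kappa>\<^sup>2) + \<kappa> / (1 - \<kappa>\<^sup>2))) UNIV"
    proof (rule has_sum_int_split)
      have "nat \<bar>int k + 1\<bar> = Suc k" "nat \<bar>int k + 1 - 1\<bar> = k" "nat \<bar>- int k\<bar> = k" "nat \<bar>- int k - 1\<bar> = Suc k" for k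
        by auto
      moreover have "\<kappa> ^ Suc k * \<kappa> ^ k = \<kappa> * (\<kappa>\<^sup>2) ^ k" "\<kappa> ^ k * \<kappa> ^ Suc k = \<kappa> * (\<kappa>\<^sup>2) ^ k" for k
        by (simp_all add: power_mult_distrib power2_eq_square)
      ultimately show "((\<lambda>k. \<kappa> ^ nat \<bar>int k + 1\<bar> * \<kappa> ^ nat \<bar>int k + 1 - 1\<bar>) has_sum (\<kappa> / (1 - \<kappa>\<^sup>2))) UNIV"
        "((\<lambda>k. \<kappa> ^ nat \<bar>- int k\<bar> * \<kappa> ^ nat \<bar>- int k - 1\<bar>) has_sum (\<kappa> / (1 - \<kappa>\<^sup>2))) UNIV"
        using has_sum_geometric[of "\<kappa>\<^sup>2" \<kappa>] \<kappa>sq1 by (simp_all only: zero_le_power2)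
    qed
    have "((\<lambda>n. t * (\<kappa> ^ nat \<bar>n\<bar> * \<kappa> ^ nat \<bar>n - 1\<bar>)) has_sum s) UNIV"
    proof -
      have "t * (\<kappa> / (1 - \<kappa>\<^sup>2) + \<kappa> / (1 - \<kappa>\<^sup>2)) = s"
      proof -
        have "\<kappa> / (1 - \<kappa>\<^sup>2) = s / (2 * t)"
          unfolding minus unfolding \<kappa>_def using t t1 by simp
        then show ?thesis
          using t by simp
      qed
      then show ?thesis
        using has_sum_cmult_right[OF two_sided, of t] by (simp only:)
    qed
    then have "((\<lambda>n. cinner (number_basis n) (?\<rho> (number_basis (n - 1)))) has_sum of_real s) UNIV"
      unfolding z by (rule has_sum_of_real)
    then show ?thesis
      using has_sum_unique[OF circular_mean_has_sum[OF \<rho>]] by blast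
  qed
  ultimately show thesis
    using that[OF \<rho>] s by simp
qed

theorem mainTheorem4:
  shows "(\<forall>\<rho>. density_operator \<rho> \<longrightarrow>
            discrete_variance \<rho> \<ge> 1 - 1 / 2 * sqrt (chordal_variance \<rho> * (4 - chordal_variance \<rho>))) \<and>
         (\<forall>x::real. 0 < x \<and> x \<le> 2 \<longrightarrow>
            (INF \<rho>\<in>{\<rho>. density_operator \<rho> \<and> chordal_variance \<rho> \<le> x}. discrete_variance \<rho>)
              = 1 - 1 / 2 * sqrt (x * (4 - x)))"
proof (intro conjI allI impI)
  fix x :: real assume x: "0 < x \<and> x \<le> 2"
  let ?c = "1 - 1 / 2 * sqrt (x * (4 - x))"
  have lower: "?c \<le> discrete_variance \<rho>" if \<rho>: "density_operator \<rho>" "chordal_variance \<rho> \<le> x" for \<rho>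
  proof -
    \<comment> \<open>This product is x (4 - x) - V (4 - V) for the chordal variance V; both factors
      are nonnegative because V <= x <= 2.\<close>
    have "0 \<le> (x - chordal_variance \<rho>) * (4 - x - chordal_variance \<rho>)"
      using x \<rho>(2) by (intro mult_nonneg_nonneg) auto
    then have "chordal_variance \<rho> * (4 - chordal_variance \<rho>) \<le> x * (4 - x)"
      by (simp add: algebra_simps)
    then have "sqrt (chordal_variance \<rho> * (4 - chordal_variance \<rho>)) \<le> sqrt (x * (4 - x))"
      by (rule real_sqrt_le_mono)
    then show ?thesis
      using discrete_variance_bound[OF \<rho>(1)] by linarith
  qed
  \<comment> \<open>s solves 2 (1 - s) = x, and t = sqrt (1 - s^2), so the optimal state meets the
    constraint with equality.\<close>
  define s t where "s = 1 - x / 2" and "t = sqrt (x * (4 - x)) / 2"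
  have "0 < x * (4 - x)"
    using x by simp
  then have st: "0 \<le> s" "0 < t" "s\<^sup>2 + t\<^sup>2 = 1"
    using x by (auto simp: s_def t_def power2_eq_square field_simps)
  obtain \<rho> where \<rho>: "density_operator \<rho>" "cmod (circular_mean \<rho>) = s" "number_distribution \<rho> 0 = t"
    using optimal_state_exists[OF st] by blast
  have cv: "chordal_variance \<rho> = x"
    by (simp add: chordal_variance_eq[OF \<rho>(1)] \<rho>(2) s_def)
  have "discrete_variance \<rho> \<le> ?c"
    using discrete_variance_le[OF \<rho>(1), of 0] by (simp add: \<rho>(3) t_def)
  then have "discrete_variance \<rho> = ?c"
    using lower[OF \<rho>(1)] cv by simp
  then show "(INF \<rho>\<in>{\<rho>. density_operator \<rho> \<and> chordal_variance \<rho> \<le> x}. discrete_variance \<rho>) = ?c"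
    using lower \<rho>(1) cv by (intro cInf_eq_minimum) (auto intro!: image_eqI[of _ _ \<rho>])
qed (rule discrete_variance_bound)

end
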